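(* The theory of topological spaces is decidable: the set of formulae $\phi\in\mathcal{L}$ that are valid in every topological model is decidable.
   Context: Language: $\mathsf{A}$ is a countable set of atomic formulae (given with an effective enumeration) with two distinguished elements $\top,\bot$. $\mathcal{L}$ is the least set containing $\mathsf{A}$ and closed under $\phi\land\psi$, $\neg\phi$, $\Box\phi$, $\mathsf{K}\phi$. A topological model is a triple $\langle X,\mathcal{T},i\rangle$ with $\mathcal{T}$ a topology on the set $X$ and $i:\mathsf{A}\to\mathcal{P}(X)$ with $i(\top)=X$, $i(\bot)=\emptyset$. Satisfaction is defined for pairs $(x,U)$ with $x\in U\in\mathcal{T}$: $x,U\models A$ iff $x\in i(A)$ for atomic $A$; Boolean connectives as usual; $x,U\models\mathsf{K}\phi$ iff $y,U\models\phi$ for all $y\in U$; $x,U\models\Box\phi$ iff $x,V\models\phi$ for all $V\in\mathcal{T}$ with $x\in V\subseteq U$. A formula is valid in the model if it is satisfied at all $(x,U)$ with $x\in U\in\mathcal{T}$. *)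

theory Defs
  imports "HOL-Library.Nat_Bijection" "HOL-Analysis.Abstract_Topology"
begin

section \<open>Formulae and topological models\<close>

datatype 'a fm =
    Atom 'a
  | Conj "'a fm" "'a fm"
  | Neg "'a fm"
  | Box "'a fm"
  | Know "'a fm"

text \<open>The set of points of a model is the carrier \<open>topspace T\<close> of the topology.\<close>

definition topological_model :: "'a \<Rightarrow> 'a \<Rightarrow> 'x topology \<Rightarrow> ('a \<Rightarrow> 'x set) \<Rightarrow> bool" where
  "topological_model tt ff T i \<longleftrightarrow>
     (\<forall>a. i a \<subseteq> topspace T) \<and> i tt = topspace T \<and> i ff = {}"

text \<open>Satisfaction is only meaningful at pairs \<open>(x, U)\<close> with \<open>x \<in> U\<close> and \<open>openin T U\<close>;
  the clauses for \<open>Know\<close> and \<open>Box\<close> never leave this set of pairs.\<close>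

fun sat :: "'x topology \<Rightarrow> ('a \<Rightarrow> 'x set) \<Rightarrow> 'x \<Rightarrow> 'x set \<Rightarrow> 'a fm \<Rightarrow> bool" where
  "sat T i x U (Atom a) \<longleftrightarrow> x \<in> i a"
| "sat T i x U (Conj p q) \<longleftrightarrow> sat T i x U p \<and> sat T i x U q"
| "sat T i x U (Neg p) \<longleftrightarrow> \<not> sat T i x U p"
| "sat T i x U (Box p) \<longleftrightarrow> (\<forall>V. openin T V \<and> x \<in> V \<and> V \<subseteq> U \<longrightarrow> sat T i x V p)"
| "sat T i x U (Know p) \<longleftrightarrow> (\<forall>y\<in>U. sat T i y U p)"

definition valid_in :: "'x topology \<Rightarrow> ('a \<Rightarrow> 'x set) \<Rightarrow> 'a fm \<Rightarrow> bool" where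
  "valid_in T i p \<longleftrightarrow> (\<forall>x U. openin T U \<and> x \<in> U \<longrightarrow> sat T i x U p)"

text \<open>HOL cannot quantify over all types inside a formula, so validity in every topological
  model is relative to a type from which the points of the models are drawn.\<close>

definition valid :: "'x itself \<Rightarrow> 'a \<Rightarrow> 'a \<Rightarrow> 'a fm \<Rightarrow> bool" where
  "valid _ tt ff p \<longleftrightarrow>
     (\<forall>(T :: 'x topology) i. topological_model tt ff T i \<longrightarrow> valid_in T i p)"

section \<open>Decidable sets\<close>

text \<open>Kleene's partial recursive functions. The recursion argument of \<open>PrimRec\<close> and the search
  variable of \<open>Mu\<close> come first in the argument list.\<close>

datatype recf =
    Zero
  | Succ
  | Proj nat
  | Comp recf "recf list"
  | PrimRec recf recf
  | Mu recf

text \<open>\<open>rec_eval f xs y\<close>: the value of \<open>f\<close> at \<open>xs\<close> is defined and equal to \<open>y\<close>.\<close>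

inductive rec_eval :: "recf \<Rightarrow> nat list \<Rightarrow> nat \<Rightarrow> bool" where
  Zero: "rec_eval Zero xs 0"
| Succ: "rec_eval Succ [x] (Suc x)"
| Proj: "k < length xs \<Longrightarrow> rec_eval (Proj k) xs (xs ! k)"
| Comp: "list_all2 (\<lambda>g y. rec_eval g xs y) gs ys \<Longrightarrow> rec_eval f ys z \<Longrightarrow>
    rec_eval (Comp f gs) xs z"
| PrimRec_0: "rec_eval f xs y \<Longrightarrow> rec_eval (PrimRec f g) (0 # xs) y"
| PrimRec_Suc: "rec_eval (PrimRec f g) (n # xs) y \<Longrightarrow> rec_eval g (n # y # xs) z \<Longrightarrow>
    rec_eval (PrimRec f g) (Suc n # xs) z"
| Mu: "rec_eval f (n # xs) 0 \<Longrightarrow> (\<And>m. m < n \<Longrightarrow> \<exists>y. rec_eval f (m # xs) (Suc y)) \<Longrightarrow>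
    rec_eval (Mu f) xs n"

inductive_cases rec_eval_ZeroE: "rec_eval Zero xs y"
inductive_cases rec_eval_SuccE: "rec_eval Succ xs y"
inductive_cases rec_eval_ProjE: "rec_eval (Proj k) xs y"
inductive_cases rec_eval_CompE: "rec_eval (Comp f gs) xs y"
inductive_cases rec_eval_PrimRec_0E: "rec_eval (PrimRec f g) (0 # xs) y"
inductive_cases rec_eval_PrimRec_SucE: "rec_eval (PrimRec f g) (Suc n # xs) y"
inductive_cases rec_eval_MuE: "rec_eval (Mu f) xs y"

lemma rec_eval_functional: "rec_eval f xs y \<Longrightarrow> rec_eval f xs z \<Longrightarrow> y = z"
proof (induction arbitrary: z rule: rec_eval.induct)
  case (Zero xs)
  then show ?case by (rule rec_eval_ZeroE) simp
next
  case (Succ x)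
  then show ?case by (rule rec_eval_SuccE) simp
next
  case (Proj k xs)
  from Proj.prems show ?case by (rule rec_eval_ProjE) simp
next
  case (Comp xs gs ys f z z')
  from Comp.prems obtain ys' where ys': "list_all2 (\<lambda>g y. rec_eval g xs y) gs ys'"
    and z': "rec_eval f ys' z'"
    by (rule rec_eval_CompE)
  have "ys = ys'"
  proof (rule nth_equalityI)
    show len: "length ys = length ys'"
      using list_all2_lengthD[OF Comp.IH(1)] list_all2_lengthD[OF ys'] by simp
    show "ys ! k = ys' ! k" if "k < length ys" for k
      using list_all2_nthD2[OF Comp.IH(1) that] list_all2_nthD2[OF ys', of k] that len
      by simp
  qed
  then show ?case
    using Comp.IH(2) z' by blast
next
  case (PrimRec_0 f xs y g)
  from PrimRec_0.prems have "rec_eval f xs z" by (rule rec_eval_PrimRec_0E)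
  then show ?case by (rule PrimRec_0.IH)
next
  case (PrimRec_Suc f g n xs y z z')
  from PrimRec_Suc.prems obtain y' where
    "rec_eval (PrimRec f g) (n # xs) y'" "rec_eval g (n # y' # xs) z'"
    by (rule rec_eval_PrimRec_SucE)
  then show ?case using PrimRec_Suc.IH by blast
next
  case (Mu f n xs)
  from Mu.prems obtain "rec_eval f (z # xs) 0"
    and less: "\<And>m. m < z \<Longrightarrow> \<exists>y. rec_eval f (m # xs) (Suc y)"
    by (rule rec_eval_MuE) blast
  then have "\<not> z < n" using Mu.IH(2) by fastforce
  moreover have "\<not> n < z" using Mu.IH(1) less by fastforce
  ultimately show ?case by simp
qed

definition decidable :: "nat set \<Rightarrow> bool" where
  "decidable A \<longleftrightarrow> (\<exists>f. \<forall>n. rec_eval f [n] (if n \<in> A then 1 else 0))"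

text \<open>Goedel numbering of formulae, given the position \<open>c a\<close> of each atom \<open>a\<close> in an
  enumeration of the atoms.\<close>

fun fm_code :: "('a \<Rightarrow> nat) \<Rightarrow> 'a fm \<Rightarrow> nat" where
  "fm_code c (Atom a) = prod_encode (0, c a)"
| "fm_code c (Conj p q) = prod_encode (1, prod_encode (fm_code c p, fm_code c q))"
| "fm_code c (Neg p) = prod_encode (2, fm_code c p)"
| "fm_code c (Box p) = prod_encode (3, fm_code c p)"
| "fm_code c (Know p) = prod_encode (4, fm_code c p)"

text \<open>An enumeration of the atoms without repetitions, for which it is decidable which numbers
  are positions of atoms; there may be finitely or infinitely many atoms.\<close>

definition effective_enumeration :: "('a \<Rightarrow> nat) \<Rightarrow> bool" where
  "effective_enumeration c \<longleftrightarrow> inj c \<and> decidable (range c)"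

definition decidable_fms :: "('a \<Rightarrow> nat) \<Rightarrow> 'a fm set \<Rightarrow> bool" where
  "decidable_fms c F \<longleftrightarrow> decidable (fm_code c ` F)"

end

theory Submission
  imports Defs
begin

text \<open>A finite family \<open>F\<close> of opens determines \<open>p\<close> if the truth of \<open>p\<close> at \<open>(x, V)\<close> depends only
  on \<open>x\<close> and on which members of \<open>F\<close> include \<open>V\<close>. By induction on \<open>p\<close> every model has such a family,
  of size bounded by a function of \<open>p\<close>. Identifying points that lie in the same members of \<open>F\<close> and
  satisfy the same atoms of \<open>p\<close>, with the quotient topology, preserves the truth of \<open>p\<close> at saturated
  opens. Hence \<open>p\<close> is valid iff it holds in the finitely many models below an explicit size bound.
  Finite spaces and truth tables for formulae up to a given code are coded by numbers read as finite
  sets of numbers, so this condition involves only bounded quantifiers, and is computable.\<close>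

section \<open>Computable functions\<close>

text \<open>The obstacle is that \<open>Box\<close> ranges over all smaller opens of an arbitrary
  space. Merging points alone gives no control over these opens, and since the opens of the finite
  model must again be sets of its points, pairs \<open>(x, U)\<close> cannot be merged freely. The
  remedy: for truth, an open \<open>V\<close> may be exchanged for the intersection of the members
  of \<open>F\<close> above it. This open includes \<open>V\<close>, is included in the same members
  of \<open>F\<close>, and is a union of classes of points that \<open>F\<close> does not separate.
  Finiteness of \<open>F\<close> is used twice: such intersections are open, and there are finitely
  many classes. Along subformulae \<open>F\<close> gains opens of two forms, interiors for
  \<open>Know\<close> and Heyting implications for \<open>Box\<close>, and each step has an explicit
  exponential bound. On the computational side no function is defined by recursion over formulae: a
  table is quantified over as one number and checked clause by clause, and the clauses leave only
  one choice for the entries that matter. The type of points enters only through its capacity, as a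
  finite countermodel can be moved into any infinite type.\<close>

text \<open>The argument list serves as an environment of de Bruijn variables \<open>hd xs\<close>, \<open>hd (tl xs)\<close>, \<open>\<dots>\<close>:
  each bounded quantifier pushes its variable to the front, so that membership of a formula in the
  class is established by resolution with the closure rules.\<close>

definition computable :: "nat \<Rightarrow> (nat list \<Rightarrow> nat) \<Rightarrow> bool" where
  "computable k f \<longleftrightarrow> (\<exists>r. \<forall>xs. length xs = k \<longrightarrow> rec_eval r xs (f xs))"

definition computable_pred :: "nat \<Rightarrow> (nat list \<Rightarrow> bool) \<Rightarrow> bool" where
  "computable_pred k P \<longleftrightarrow> computable k (\<lambda>xs. of_bool (P xs))"

section \<open>Composition, weakening, substitution and primitive recursion\<close>

lemma computable_cong:
  "(\<And>xs. length xs = k \<Longrightarrow> f xs = g xs) \<Longrightarrow> computable k f \<longleftrightarrow> computable k g"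
  unfolding computable_def by (metis (no_types, lifting))

lemma computable_nth: "i < k \<Longrightarrow> computable k (\<lambda>xs. xs ! i)"
  unfolding computable_def using rec_eval.Proj by blast

lemma computable_comp:
  assumes F: "computable (length gs) F" and gs: "\<And>g. g \<in> set gs \<Longrightarrow> computable k g"
  shows "computable k (\<lambda>xs. F (map (\<lambda>g. g xs) gs))"
proof -
  obtain r where r: "\<And>ys. length ys = length gs \<Longrightarrow> rec_eval r ys (F ys)"
    using F unfolding computable_def by blast
  have "\<forall>g\<in>set gs. \<exists>s. \<forall>xs. length xs = k \<longrightarrow> rec_eval s xs (g xs)"
    using gs unfolding computable_def by blast
  then obtain s where s: "\<And>g xs. g \<in> set gs \<Longrightarrow> length xs = k \<Longrightarrow> rec_eval (s g) xs (g xs)"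
    by metis
  have "rec_eval (Comp r (map s gs)) xs (F (map (\<lambda>g. g xs) gs))" if "length xs = k" for xs
    by (rule rec_eval.Comp[where ys = "map (\<lambda>g. g xs) gs"])
      (auto simp: list_all2_conv_all_nth s that r)
  then show ?thesis unfolding computable_def by blast
qed

lemma computable_hd: "computable (Suc k) (\<lambda>xs. hd xs)"
  using computable_nth[of 0 "Suc k"]
  by (subst computable_cong[where g = "\<lambda>xs. xs ! 0"]) (auto simp: hd_conv_nth simp flip: length_greater_0_conv)

lemma computable_tl:
  assumes "computable k f" shows "computable (Suc k) (\<lambda>xs. f (tl xs))"
proof -
  have "computable (Suc k) (\<lambda>xs. f (map (\<lambda>g. g xs) (map (\<lambda>i xs. xs ! i) [1..<Suc k])))"
    by (rule computable_comp) (use assms in \<open>auto intro: computable_nth simp del: upt_Suc\<close>)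
  moreover have "map (\<lambda>g. g xs) (map (\<lambda>i xs. xs ! i) [1..<Suc k]) = tl xs"
    if "length xs = Suc k" for xs :: "nat list"
    using that by (auto intro!: nth_equalityI simp: nth_tl simp del: upt_Suc)
  ultimately show ?thesis
    by (subst (asm) computable_cong[where g = "\<lambda>xs. f (tl xs)"]) auto
qed

text \<open>Substitution for the front variable. \<open>PrimRec\<close> recurses on its first
  argument; this turns it into recursion up to any computable bound.\<close>

lemma computable_let:
  assumes Q: "computable (Suc k) (\<lambda>ys. Q (hd ys) (tl ys))" and b: "computable k b"
  shows "computable k (\<lambda>xs. Q (b xs) xs)"
proof -
  let ?gs = "b # map (\<lambda>i xs. xs ! i) [0..<k]"
  have "computable k (\<lambda>xs. (\<lambda>ys. Q (hd ys) (tl ys)) (map (\<lambda>g. g xs) ?gs))"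
    by (rule computable_comp) (use assms in \<open>auto intro: computable_nth\<close>)
  moreover have "map (\<lambda>g. g xs) (map (\<lambda>i xs. xs ! i) [0..<k]) = xs"
    if "length xs = k" for xs :: "nat list"
    using that by (auto intro!: nth_equalityI)
  ultimately show ?thesis
    by (subst (asm) computable_cong[where g = "\<lambda>xs. Q (b xs) xs"]) auto
qed

lemma computable_comp1:
  "computable (Suc 0) (\<lambda>xs. F (hd xs)) \<Longrightarrow> computable k f \<Longrightarrow> computable k (\<lambda>xs. F (f xs))"
  using computable_comp[of "[f]" "\<lambda>xs. F (hd xs)" k] by auto

lemma computable_pred_comp1:
  "computable_pred (Suc 0) (\<lambda>xs. P (hd xs)) \<Longrightarrow> computable k f \<Longrightarrow>
    computable_pred k (\<lambda>xs. P (f xs))"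
  unfolding computable_pred_def using computable_comp[of "[f]" "\<lambda>xs. of_bool (P (hd xs))" k]
  by auto

lemma computable_pred_comp2:
  "computable_pred (Suc (Suc 0)) (\<lambda>xs. P (hd xs) (hd (tl xs))) \<Longrightarrow>
    computable k f \<Longrightarrow> computable k g \<Longrightarrow> computable_pred k (\<lambda>xs. P (f xs) (g xs))"
  unfolding computable_pred_def
  using computable_comp[of "[f, g]" "\<lambda>xs. of_bool (P (hd xs) (hd (tl xs)))" k] by auto

lemma computable_pred_comp3:
  "computable_pred (Suc (Suc (Suc 0))) (\<lambda>xs. P (hd xs) (hd (tl xs)) (hd (tl (tl xs)))) \<Longrightarrow>
    computable k f \<Longrightarrow> computable k g \<Longrightarrow> computable k h \<Longrightarrow>
    computable_pred k (\<lambda>xs. P (f xs) (g xs) (h xs))"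
  unfolding computable_pred_def
  using computable_comp[of "[f, g, h]" "\<lambda>xs. of_bool (P (hd xs) (hd (tl xs)) (hd (tl (tl xs))))" k]
  by auto

lemma computable_rec:
  assumes f: "computable k f"
    and h: "computable (Suc (Suc k)) (\<lambda>xs. h (hd xs) (hd (tl xs)) (tl (tl xs)))"
    and b: "computable k b"
  shows "computable k (\<lambda>xs. rec_nat (f xs) (\<lambda>n y. h n y xs) (b xs))"
proof -
  obtain r where r: "\<And>xs. length xs = k \<Longrightarrow> rec_eval r xs (f xs)"
    using f unfolding computable_def by blast
  obtain s where s: "\<And>xs. length xs = Suc (Suc k) \<Longrightarrow>
      rec_eval s xs (h (hd xs) (hd (tl xs)) (tl (tl xs)))"
    using h unfolding computable_def by blast
  have *: "rec_eval (PrimRec r s) (n # xs) (rec_nat (f xs) (\<lambda>n y. h n y xs) n)"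
    if "length xs = k" for n xs
  proof (induction n)
    case 0
    show ?case using r[OF that] by (auto intro: rec_eval.PrimRec_0)
  next
    case (Suc n)
    show ?case using rec_eval.PrimRec_Suc[OF Suc.IH] s[of "n # _ # xs"] that by simp
  qed
  have "rec_eval (PrimRec r s) xs (rec_nat (f (tl xs)) (\<lambda>n y. h n y (tl xs)) (hd xs))"
    if "length xs = Suc k" for xs
    using that *[of "tl xs" "hd xs"] by (cases xs) auto
  then have "computable (Suc k)
      (\<lambda>xs. rec_nat (f (tl xs)) (\<lambda>n y. h n y (tl xs)) (hd xs))"
    unfolding computable_def by blast
  from computable_let[where Q = "\<lambda>m xs. rec_nat (f xs) (\<lambda>n y. h n y xs) m", OF this b]
  show ?thesis .
qed

lemma computable_Suc: "computable k f \<Longrightarrow> computable k (\<lambda>xs. Suc (f xs))"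
proof (rule computable_comp1[where F = Suc])
  have "rec_eval Succ xs (Suc (hd xs))" if "length xs = Suc 0" for xs
    using that rec_eval.Succ by (cases xs) auto
  then show "computable (Suc 0) (\<lambda>xs. Suc (hd xs))"
    unfolding computable_def by blast
qed

lemma computable_const: "computable k (\<lambda>xs. n)"
proof (induction n)
  case 0
  show ?case unfolding computable_def using rec_eval.Zero by blast
next
  case (Suc n)
  then show ?case by (rule computable_Suc)
qed

text \<open>Ten variables are what \<open>all_models_satisfy\<close> needs: below \<open>G\<close>,
  \<open>R\<close>, \<open>I\<close>, \<open>S\<close>, \<open>q\<close>, \<open>u\<close>,
  \<open>x\<close>, \<open>a\<close>, \<open>v\<close> the clause for \<open>Box\<close> still
  refers to the formula code \<open>n\<close>, through \<open>model_bound n\<close> in the bound on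
  \<open>y\<close>.\<close>

lemmas computable_vars =
  computable_hd
  computable_tl[OF computable_hd]
  computable_tl[OF computable_tl[OF computable_hd]]
  computable_tl[OF computable_tl[OF computable_tl[OF computable_hd]]]
  computable_tl[OF computable_tl[OF computable_tl[OF computable_tl[OF computable_hd]]]]
  computable_tl[OF computable_tl[OF computable_tl[OF computable_tl[OF computable_tl[OF
    computable_hd]]]]]
  computable_tl[OF computable_tl[OF computable_tl[OF computable_tl[OF computable_tl[OF
    computable_tl[OF computable_hd]]]]]]
  computable_tl[OF computable_tl[OF computable_tl[OF computable_tl[OF computable_tl[OF
    computable_tl[OF computable_tl[OF computable_hd]]]]]]]
  computable_tl[OF computable_tl[OF computable_tl[OF computable_tl[OF computable_tl[OF
    computable_tl[OF computable_tl[OF computable_tl[OF computable_hd]]]]]]]]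
  computable_tl[OF computable_tl[OF computable_tl[OF computable_tl[OF computable_tl[OF
    computable_tl[OF computable_tl[OF computable_tl[OF computable_tl[OF computable_hd]]]]]]]]]

section \<open>Arithmetic functions\<close>

lemma computable_add:
  assumes "computable k f" "computable k g"
  shows "computable k (\<lambda>xs. f xs + g xs)"
proof -
  have "rec_nat m (\<lambda>_ y. Suc y) n = m + n" for m n :: nat by (induction n) auto
  then show ?thesis
    using computable_rec[OF assms(1) _ assms(2), of "\<lambda>_ y _. Suc y"]
    by (simp add: computable_Suc computable_vars)
qed

lemma computable_mult:
  assumes "computable k f" "computable k g"
  shows "computable k (\<lambda>xs. f xs * g xs)"
proof -
  have "rec_nat 0 (\<lambda>_ y. y + m) n = m * n" for m n :: nat by (induction n) auto
  then show ?thesis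
    using computable_rec[OF computable_const[of k 0] _ assms(2), of "\<lambda>_ y xs. y + f xs"]
    by (simp add: computable_add[OF computable_vars(2) computable_tl[OF computable_tl[OF assms(1)]]])
qed

lemma computable_power2:
  assumes "computable k f"
  shows "computable k (\<lambda>xs. 2 ^ f xs)"
proof -
  have "rec_nat 1 (\<lambda>_ y. y + y) n = (2 :: nat) ^ n" for n by (induction n) auto
  then show ?thesis
    using computable_rec[OF computable_const[of k 1] _ assms, of "\<lambda>_ y xs. y + y"]
    by (simp add: computable_add computable_vars)
qed

lemma computable_pred_nat:
  assumes "computable k f"
  shows "computable k (\<lambda>xs. f xs - 1)"
proof -
  have "rec_nat 0 (\<lambda>m _. m) n = n - 1" for n :: nat by (cases n) auto
  then show ?thesis
    using computable_rec[OF computable_const[of k 0] _ assms, of "\<lambda>m _ _. m"]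
    by (simp add: computable_vars)
qed

lemma computable_diff:
  assumes "computable k f" "computable k g"
  shows "computable k (\<lambda>xs. f xs - g xs)"
proof -
  have "rec_nat m (\<lambda>_ y. y - 1) n = m - n" for m n :: nat by (induction n) auto
  then show ?thesis
    using computable_rec[OF assms(1) _ assms(2), of "\<lambda>_ y _. y - 1"]
      computable_pred_nat[OF computable_vars(2)[of k]]
    by simp
qed

lemma computable_prod_encode:
  assumes "computable k f" "computable k g"
  shows "computable k (\<lambda>xs. prod_encode (f xs, g xs))"
proof -
  have tri: "rec_nat 0 (\<lambda>m y. y + Suc m) n = triangle n" for n :: nat by (induction n) auto
  have "computable k (\<lambda>xs. triangle (f xs + g xs))"
    using computable_rec[OF computable_const[of k 0] _ computable_add[OF assms],
        of "\<lambda>m y _. y + Suc m"]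
      computable_add[OF computable_vars(2) computable_Suc[OF computable_vars(1)], of k] tri
    by simp
  then show ?thesis
    unfolding prod_encode_def by (simp add: computable_add assms)
qed

section \<open>Connectives, comparisons and bounded quantifiers\<close>

lemma computable_pred_not:
  "computable_pred k P \<Longrightarrow> computable_pred k (\<lambda>xs. \<not> P xs)"
  unfolding computable_pred_def of_bool_not_iff
  using computable_diff[OF computable_const[of k 1], of "\<lambda>xs. of_bool (P xs)"]
  by (subst computable_cong[where g = "\<lambda>xs. 1 - of_bool (P xs)"]) auto

lemma computable_pred_conj:
  "computable_pred k P \<Longrightarrow> computable_pred k Q \<Longrightarrow> computable_pred k (\<lambda>xs. P xs \<and> Q xs)"
  unfolding computable_pred_def of_bool_conj by (rule computable_mult)

lemma computable_pred_disj:
  "computable_pred k P \<Longrightarrow> computable_pred k Q \<Longrightarrow> computable_pred k (\<lambda>xs. P xs \<or> Q xs)"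
  using computable_pred_not[OF computable_pred_conj[OF computable_pred_not computable_pred_not]]
  by fastforce

lemma computable_pred_imp:
  "computable_pred k P \<Longrightarrow> computable_pred k Q \<Longrightarrow> computable_pred k (\<lambda>xs. P xs \<longrightarrow> Q xs)"
  unfolding imp_conv_disj by (intro computable_pred_disj computable_pred_not)

lemma computable_pred_iff:
  "computable_pred k P \<Longrightarrow> computable_pred k Q \<Longrightarrow> computable_pred k (\<lambda>xs. P xs \<longleftrightarrow> Q xs)"
  unfolding iff_conv_conj_imp by (intro computable_pred_conj computable_pred_imp)

lemma computable_pred_le:
  assumes "computable k f" "computable k g"
  shows "computable_pred k (\<lambda>xs. f xs \<le> g xs)"
proof -
  have "of_bool (m \<le> n) = 1 - (m - n)" for m n :: nat by auto
  then show ?thesis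
    unfolding computable_pred_def
    using computable_diff[OF computable_const[of k 1] computable_diff[OF assms]] by simp
qed

lemma computable_pred_less:
  "computable k f \<Longrightarrow> computable k g \<Longrightarrow> computable_pred k (\<lambda>xs. f xs < g xs)"
  unfolding Suc_le_eq[symmetric] by (intro computable_pred_le computable_Suc)

lemma computable_pred_eq:
  "computable k f \<Longrightarrow> computable k g \<Longrightarrow> computable_pred k (\<lambda>xs. f xs = g xs)"
  unfolding eq_iff[where ?'a = nat] by (intro computable_pred_conj computable_pred_le)

text \<open>The truth value is the product of those of the instances, accumulated by primitive
  recursion.\<close>

lemma computable_pred_all_less:
  assumes P: "computable_pred (Suc k) (\<lambda>ys. P (hd ys) (tl ys))" and b: "computable k b"
  shows "computable_pred k (\<lambda>xs. \<forall>y<b xs. P y xs)"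
proof -
  have rec: "rec_nat 1 (\<lambda>m y. y * of_bool (P m xs)) n = (of_bool (\<forall>y<n. P y xs) :: nat)" for n xs
    by (induction n) (auto simp: less_Suc_eq)
  have "computable k (\<lambda>xs. rec_nat 1 (\<lambda>m y. y * of_bool (P m xs)) (b xs))"
  proof (rule computable_rec[OF computable_const _ b])
    \<comment> \<open>The recursion step receives the counter, the accumulator and then the
      parameters; \<open>P\<close> has to be evaluated with the accumulator, at position 1, left
      out.\<close>
    let ?gs = "hd # map (\<lambda>i xs. xs ! i) [2..<Suc (Suc k)]"
    have "computable (Suc (Suc k))
        (\<lambda>xs. (\<lambda>ys. of_bool (P (hd ys) (tl ys))) (map (\<lambda>g. g xs) ?gs))"
      by (rule computable_comp)
        (use P in \<open>auto simp: computable_pred_def intro: computable_nth computable_hd simp del: upt_Suc\<close>)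
    moreover have "map (\<lambda>g. g xs) (map (\<lambda>i xs. xs ! i) [2..<Suc (Suc k)]) = tl (tl xs)"
      if "length xs = Suc (Suc k)" for xs :: "nat list"
      using that by (auto intro!: nth_equalityI simp: nth_tl simp del: upt_Suc)
    ultimately have "computable (Suc (Suc k)) (\<lambda>xs. of_bool (P (hd xs) (tl (tl xs))))"
      by (subst (asm) computable_cong[where g = "\<lambda>xs. of_bool (P (hd xs) (tl (tl xs)))"]) auto
    then show "computable (Suc (Suc k))
        (\<lambda>xs. hd (tl xs) * of_bool (P (hd xs) (tl (tl xs))))"
      by (rule computable_mult[OF computable_vars(2)])
  qed
  then show ?thesis unfolding computable_pred_def rec .
qed

lemma computable_pred_ex_less:
  "computable_pred (Suc k) (\<lambda>ys. P (hd ys) (tl ys)) \<Longrightarrow> computable k b \<Longrightarrow>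
    computable_pred k (\<lambda>xs. \<exists>y<b xs. P y xs)"
  using computable_pred_not[OF computable_pred_all_less[of k "\<lambda>y xs. \<not> P y xs" b]]
    computable_pred_not[of "Suc k" "\<lambda>ys. P (hd ys) (tl ys)"]
  by simp

lemma computable_pred_all_le:
  "computable_pred (Suc k) (\<lambda>ys. P (hd ys) (tl ys)) \<Longrightarrow> computable k b \<Longrightarrow>
    computable_pred k (\<lambda>xs. \<forall>y\<le>b xs. P y xs)"
  unfolding less_Suc_eq_le[symmetric] by (intro computable_pred_all_less computable_Suc)

lemma computable_pred_ex_le:
  "computable_pred (Suc k) (\<lambda>ys. P (hd ys) (tl ys)) \<Longrightarrow> computable k b \<Longrightarrow>
    computable_pred k (\<lambda>xs. \<exists>y\<le>b xs. P y xs)"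
  unfolding less_Suc_eq_le[symmetric] by (intro computable_pred_ex_less computable_Suc)

lemmas computable_intros =
  computable_vars computable_const computable_Suc computable_add computable_mult
  computable_power2 computable_prod_encode
  computable_pred_not computable_pred_conj computable_pred_disj computable_pred_imp
  computable_pred_iff computable_pred_le computable_pred_less computable_pred_eq
  computable_pred_all_less computable_pred_all_le computable_pred_ex_less computable_pred_ex_le

text \<open>Division and parity are replaced by bounded witnesses so that the closure rules apply:
  \<open>2 * a + 1\<close> is the odd quotient of \<open>m\<close> by \<open>2 ^ k\<close>, and
  \<open>r\<close> the remainder.\<close>

lemma in_set_decode_iff:
  "k \<in> set_decode m \<longleftrightarrow> (\<exists>a\<le>m. \<exists>r<2 ^ k. m = (2 * a + 1) * 2 ^ k + r)"
proof
  assume "k \<in> set_decode m"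
  then obtain a where a: "m div 2 ^ k = 2 * a + 1"
    by (auto simp: set_decode_def elim: oddE)
  have "m = (2 * a + 1) * 2 ^ k + m mod 2 ^ k"
    using div_mult_mod_eq[of m "2 ^ k"] a by simp
  moreover have "a \<le> m"
    using a div_le_dividend[of m "2 ^ k"] by linarith
  ultimately show "\<exists>a\<le>m. \<exists>r<2 ^ k. m = (2 * a + 1) * 2 ^ k + r"
    by (metis mod_less_divisor zero_less_numeral zero_less_power)
next
  assume "\<exists>a\<le>m. \<exists>r<2 ^ k. m = (2 * a + 1) * 2 ^ k + r"
  then obtain a r where r: "r < 2 ^ k" "m = (2 * a + 1) * 2 ^ k + r" by blast
  have "m div 2 ^ k = 2 * a + 1" unfolding r(2) using r(1)
    by (subst div_mult_self3) auto
  then show "k \<in> set_decode m" by (simp add: set_decode_def)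
qed

lemma computable_pred_in_set_decode:
  "computable k f \<Longrightarrow> computable k g \<Longrightarrow> computable_pred k (\<lambda>xs. f xs \<in> set_decode (g xs))"
proof (rule computable_pred_comp2[where P = "\<lambda>k m. k \<in> set_decode m"])
  show "computable_pred (Suc (Suc 0)) (\<lambda>xs. hd xs \<in> set_decode (hd (tl xs)))"
    unfolding in_set_decode_iff by (intro computable_intros)
qed

lemma computable_pred_decidable:
  "decidable A \<Longrightarrow> computable k f \<Longrightarrow> computable_pred k (\<lambda>xs. f xs \<in> A)"
proof (rule computable_pred_comp1[where P = "\<lambda>n. n \<in> A"])
  assume "decidable A"
  then obtain r where r: "\<And>n. rec_eval r [n] (of_bool (n \<in> A))"
    unfolding decidable_def of_bool_def by blast
  have "rec_eval r xs (of_bool (hd xs \<in> A))" if "length xs = Suc 0" for xs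
    using that r by (cases xs) auto
  then show "computable_pred (Suc 0) (\<lambda>xs. hd xs \<in> A)"
    unfolding computable_pred_def computable_def by blast
qed

lemma decidable_if_computable_pred:
  assumes "computable_pred (Suc 0) (\<lambda>xs. P (hd xs))"
  shows "decidable {n. P n}"
proof -
  obtain r where "\<And>xs. length xs = Suc 0 \<Longrightarrow> rec_eval r xs (of_bool (P (hd xs)))"
    using assms unfolding computable_pred_def computable_def by blast
  from this[of "[_]"] have "\<forall>n. rec_eval r [n] (of_bool (P n))" by simp
  then show ?thesis
    unfolding decidable_def of_bool_def mem_Collect_eq by blast
qed

section \<open>The finite model property\<close>

text \<open>A single recursion step pays for every connective: with \<open>b\<close> opens so far,
  \<open>Conj\<close> needs at most \<open>b + b\<close>, \<open>Box\<close> at most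
  \<open>b + 2 ^ b * b\<close> and \<open>Know\<close> at most \<open>b + 2 ^ b\<close>, all within
  \<open>Suc b * 2 ^ b\<close>. The argument will be the code of the formula, which exceeds the
  codes of its components; so the bound is computed from the code without decoding it.\<close>

primrec stable_bound :: "nat \<Rightarrow> nat" where
  "stable_bound 0 = 0"
| "stable_bound (Suc n) = Suc (stable_bound n) * 2 ^ stable_bound n"

text \<open>A point is classified by its trace on at most \<open>stable_bound n\<close> opens and by
  the atoms true at it; the atoms of a formula with code \<open>n\<close> have distinct positions
  among the \<open>Suc n\<close> numbers up to \<open>n\<close>.\<close>

definition model_bound :: "nat \<Rightarrow> nat" where
  "model_bound n = 2 ^ (stable_bound n + Suc n)"

lemma computable_model_bound:
  assumes "computable k f" shows "computable k (\<lambda>xs. model_bound (f xs))"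
proof -
  have "rec_nat 0 (\<lambda>_ y. Suc y * 2 ^ y) n = stable_bound n" for n
    by (induction n) auto
  then have "computable k (\<lambda>xs. stable_bound (f xs))"
    using computable_rec[OF computable_const[of k 0] _ assms, of "\<lambda>_ y _. Suc y * 2 ^ y"]
      computable_mult[OF computable_Suc[OF computable_vars(2)]
        computable_power2[OF computable_vars(2)], of k]
    by simp
  with assms show ?thesis
    unfolding model_bound_def by (intro computable_intros)
qed

lemma stable_bound_mono: "m \<le> n \<Longrightarrow> stable_bound m \<le> stable_bound n"
proof (rule lift_Suc_mono_le[of stable_bound])
  show "stable_bound k \<le> stable_bound (Suc k)" for k
    using mult_le_mono[of "stable_bound k" "Suc (stable_bound k)" 1 "2 ^ stable_bound k"] by simp
qed

lemma stable_bound_less: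
  assumes "m < n" shows "Suc (stable_bound m) * 2 ^ stable_bound m \<le> stable_bound n"
  using stable_bound_mono[of "Suc m" n] assms by simp

section \<open>Subformulae and the size of their codes\<close>

fun subfms :: "'a fm \<Rightarrow> 'a fm set" where
  "subfms (Atom a) = {Atom a}"
| "subfms (Conj p q) = insert (Conj p q) (subfms p \<union> subfms q)"
| "subfms (Neg p) = insert (Neg p) (subfms p)"
| "subfms (Box p) = insert (Box p) (subfms p)"
| "subfms (Know p) = insert (Know p) (subfms p)"

lemma self_in_subfms: "p \<in> subfms p"
  by (cases p) auto

text \<open>The positive tags are what makes the code of a compound formula strictly larger than
  those of its components; an atom, with tag 0, only satisfies
  \<open>c a \<le> fm_code c (Atom a)\<close>.\<close>

lemma snd_less_prod_encode: "0 < a \<Longrightarrow> b < prod_encode (a, b)"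
  using le_prod_encode_2[of "a + b" 0] by (auto simp: prod_encode_def)

lemma fm_code_less:
  "fm_code c p < fm_code c (Conj p q)" "fm_code c q < fm_code c (Conj p q)"
  "fm_code c p < fm_code c (Neg p)" "fm_code c p < fm_code c (Box p)"
  "fm_code c p < fm_code c (Know p)"
  using le_prod_encode_1[of "fm_code c p" "fm_code c q"]
    le_prod_encode_2[of "fm_code c q" "fm_code c p"]
    snd_less_prod_encode[of 1 "prod_encode (fm_code c p, fm_code c q)"]
  by (auto intro: snd_less_prod_encode)

lemma atom_le_fm_code: "a \<in> set_fm p \<Longrightarrow> c a \<le> fm_code c p"
proof (induction p)
  case (Atom b)
  then show ?case using le_prod_encode_2[of "c b" 0] by simp
next
  case (Conj p q)
  then show ?case using fm_code_less(1)[of c p q] fm_code_less(2)[of c q p] by (auto simp del: fm_code.simps)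
next
  case (Neg p)
  then show ?case using fm_code_less(3)[of c p] by (auto simp del: fm_code.simps)
next
  case (Box p)
  then show ?case using fm_code_less(4)[of c p] by (auto simp del: fm_code.simps)
next
  case (Know p)
  then show ?case using fm_code_less(5)[of c p] by (auto simp del: fm_code.simps)
qed

section \<open>Finite families of opens that determine truth\<close>

definition determines ::
  "'x topology \<Rightarrow> ('a \<Rightarrow> 'x set) \<Rightarrow> 'x set set \<Rightarrow> 'a fm \<Rightarrow> bool" where
  "determines T i F p \<longleftrightarrow> (\<forall>V V'. openin T V \<longrightarrow> openin T V' \<longrightarrow>
     (\<forall>U\<in>F. V \<subseteq> U \<longleftrightarrow> V' \<subseteq> U) \<longrightarrow> (\<forall>x\<in>V \<inter> V'. sat T i x V p \<longleftrightarrow> sat T i x V' p))"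

lemma determinesD:
  "determines T i F p \<Longrightarrow> openin T V \<Longrightarrow> openin T V' \<Longrightarrow> (\<And>U. U \<in> F \<Longrightarrow> V \<subseteq> U \<longleftrightarrow> V' \<subseteq> U) \<Longrightarrow>
    x \<in> V \<Longrightarrow> x \<in> V' \<Longrightarrow> sat T i x V p \<longleftrightarrow> sat T i x V' p"
  unfolding determines_def by blast

lemma determines_mono:
  assumes "determines T i F p" "F \<subseteq> G" shows "determines T i G p"
  unfolding determines_def
proof (intro allI impI ballI)
  fix V V' x assume "openin T V" "openin T V'" "\<forall>U\<in>G. V \<subseteq> U \<longleftrightarrow> V' \<subseteq> U" "x \<in> V \<inter> V'"
  then show "sat T i x V p \<longleftrightarrow> sat T i x V' p"
    using determinesD[OF assms(1), of V V' x] assms(2) by blast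
qed

lemma determines_Conj:
  assumes "determines T i F p" "determines T i F q" shows "determines T i F (Conj p q)"
  unfolding determines_def
proof (intro allI impI ballI)
  fix V V' x assume "openin T V" "openin T V'" "\<forall>U\<in>F. V \<subseteq> U \<longleftrightarrow> V' \<subseteq> U" "x \<in> V \<inter> V'"
  then show "sat T i x V (Conj p q) \<longleftrightarrow> sat T i x V' (Conj p q)"
    using determinesD[OF assms(1), of V V' x] determinesD[OF assms(2), of V V' x] by simp
qed

lemma determines_Neg:
  assumes "determines T i F p" shows "determines T i F (Neg p)"
  unfolding determines_def
proof (intro allI impI ballI)
  fix V V' x assume "openin T V" "openin T V'" "\<forall>U\<in>F. V \<subseteq> U \<longleftrightarrow> V' \<subseteq> U" "x \<in> V \<inter> V'"
  then show "sat T i x V (Neg p) \<longleftrightarrow> sat T i x V' (Neg p)"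
    using determinesD[OF assms, of V V' x] by simp
qed

text \<open>\<open>A s\<close> collects the points at which \<open>p\<close> holds relative to opens whose supersets in \<open>F\<close> are
  \<open>s\<close>; such an open satisfies \<open>Know p\<close> iff it is included in the interior of \<open>A s\<close>.\<close>

lemma determines_Know:
  assumes p: "determines T i F p" and F: "finite F"
  defines "A \<equiv> \<lambda>s. {x. \<exists>V. openin T V \<and> x \<in> V \<and> {U\<in>F. V \<subseteq> U} = s \<and> sat T i x V p}"
  shows "determines T i (F \<union> (\<lambda>s. T interior_of (A s)) ` Pow F) (Know p)"
  unfolding determines_def
proof (intro allI impI)
  fix V V'
  assume V: "openin T V" "openin T V'"
    and eq: "\<forall>U\<in>F \<union> (\<lambda>s. T interior_of (A s)) ` Pow F. V \<subseteq> U \<longleftrightarrow> V' \<subseteq> U"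
  define s where "s = {U\<in>F. V \<subseteq> U}"
  have s': "s = {U\<in>F. V' \<subseteq> U}" and "s \<subseteq> F" using eq unfolding s_def by blast+
  have *: "(\<forall>y\<in>W. sat T i y W p) \<longleftrightarrow> W \<subseteq> T interior_of (A s)"
    if W: "openin T W" and s: "s = {U\<in>F. W \<subseteq> U}" for W
  proof -
    have "sat T i y W p \<longleftrightarrow> y \<in> A s" if "y \<in> W" for y
    proof
      show "sat T i y W p \<Longrightarrow> y \<in> A s" using that W s unfolding A_def by blast
      assume "y \<in> A s"
      then obtain V where "openin T V" "y \<in> V" "{U\<in>F. V \<subseteq> U} = s" "sat T i y V p"
        unfolding A_def by blast
      then show "sat T i y W p"
        using determinesD[OF p _ W, of V y] that s by blast
    qed
    then have "(\<forall>y\<in>W. sat T i y W p) \<longleftrightarrow> W \<subseteq> A s" by blast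
    also have "\<dots> \<longleftrightarrow> W \<subseteq> T interior_of (A s)"
      using interior_of_maximal[OF _ W] interior_of_subset[of T "A s"] by blast
    finally show ?thesis .
  qed
  have "V \<subseteq> T interior_of (A s) \<longleftrightarrow> V' \<subseteq> T interior_of (A s)"
    using eq \<open>s \<subseteq> F\<close> by blast
  then show "\<forall>x\<in>V \<inter> V'. sat T i x V (Know p) \<longleftrightarrow> sat T i x V' (Know p)"
    using *[OF V(1) s_def] *[OF V(2) s'] by simp
qed

text \<open>If \<open>W \<subseteq> V\<close> has set of supersets \<open>s\<close> in \<open>F\<close>, then \<open>V' \<inter> \<Inter>s\<close> has the same one unless it is
  included in some \<open>U \<in> F - s\<close>, i.e. unless \<open>V'\<close> is included in the Heyting implication from \<open>\<Inter>s\<close>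
  to \<open>U\<close>.\<close>

lemma determines_Box:
  assumes p: "determines T i F p" and F: "finite F" and opens: "\<And>U. U \<in> F \<Longrightarrow> openin T U"
  shows "determines T i ((\<lambda>(s, U). T interior_of (- \<Inter>s \<union> U)) ` (Pow F \<times> F)) (Box p)"
    (is "determines T i ?G _")
proof -
  have *: "sat T i x V (Box p)"
    if V: "openin T V" "openin T V'" and eq: "\<forall>U\<in>?G. V \<subseteq> U \<longleftrightarrow> V' \<subseteq> U"
      and x: "x \<in> V" "x \<in> V'" and sat: "sat T i x V' (Box p)" for x V V'
    unfolding sat.simps
  proof (intro allI impI)
    fix W assume W: "openin T W \<and> x \<in> W \<and> W \<subseteq> V"
    define s where "s = {U\<in>F. W \<subseteq> U}"
    define W' where "W' = \<Inter>(insert V' s)"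
    have fin: "finite s" and sF: "s \<subseteq> F" unfolding s_def using F by auto
    have W': "openin T W'" unfolding W'_def
      by (rule openin_Inter) (use fin sF V opens in auto)
    have xW': "x \<in> W'" using x W unfolding W'_def s_def by auto
    have "W \<subseteq> U \<longleftrightarrow> W' \<subseteq> U" if U: "U \<in> F" for U
    proof
      show "W \<subseteq> U \<Longrightarrow> W' \<subseteq> U" using U unfolding W'_def s_def by blast
      assume "W' \<subseteq> U"
      then have "V' \<subseteq> - \<Inter>s \<union> U" unfolding W'_def by blast
      then have "V' \<subseteq> T interior_of (- \<Inter>s \<union> U)" using V by (simp add: interior_of_maximal)
      then have "V \<subseteq> T interior_of (- \<Inter>s \<union> U)" using eq U sF by blast
      then have "V \<subseteq> - \<Inter>s \<union> U" using interior_of_subset by fast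
      moreover have "W \<subseteq> \<Inter>s" unfolding s_def by blast
      ultimately show "W \<subseteq> U" using W by blast
    qed
    moreover have "sat T i x W' p" using sat W' xW' unfolding W'_def by auto
    ultimately show "sat T i x W p"
      using determinesD[OF p, of W W' x] W W' xW' by blast
  qed
  show ?thesis unfolding determines_def
  proof (intro allI impI ballI)
    fix V V' x assume "openin T V" "openin T V'" "\<forall>U\<in>?G. V \<subseteq> U \<longleftrightarrow> V' \<subseteq> U" "x \<in> V \<inter> V'"
    then show "sat T i x V (Box p) \<longleftrightarrow> sat T i x V' (Box p)"
      using *[of V V' x] *[of V' V x] by blast
  qed
qed

text \<open>One family has to serve all subformulae at once, since the transfer to the quotient
  descends through \<open>p\<close> with \<open>F\<close> fixed. Truth of an atom ignores the open,
  so the induction starts from the empty family; afterwards families only grow, and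
  \<open>determines_mono\<close> preserves what was achieved.\<close>

lemma exists_determining_family:
  "\<exists>F. finite F \<and> (\<forall>U\<in>F. openin T U) \<and> card F \<le> stable_bound (fm_code c p) \<and>
    (\<forall>q\<in>subfms p. determines T i F q)"
proof (induction p)
  case (Atom a)
  show ?case by (rule exI[of _ "{}"]) (auto simp: determines_def)
next
  case (Conj p q)
  then obtain F G where F: "finite F" "\<forall>U\<in>F. openin T U" "card F \<le> stable_bound (fm_code c p)"
      "\<forall>r\<in>subfms p. determines T i F r"
    and G: "finite G" "\<forall>U\<in>G. openin T U" "card G \<le> stable_bound (fm_code c q)"
      "\<forall>r\<in>subfms q. determines T i G r" by blast
  define n where "n = max (fm_code c p) (fm_code c q)"
  have n: "n < fm_code c (Conj p q)" unfolding n_def using fm_code_less(1,2) by (metis max_def)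
  have "card (F \<union> G) \<le> card F + card G" by (rule card_Un_le)
  also have "\<dots> \<le> stable_bound n + stable_bound n"
    unfolding n_def by (intro add_mono order_trans[OF F(3)] order_trans[OF G(3)] stable_bound_mono) auto
  also have "\<dots> \<le> Suc (stable_bound n) * 2 ^ stable_bound n"
  proof (cases "stable_bound n")
    case (Suc m)
    have "Suc m + Suc m \<le> Suc (Suc m) * 2" by simp
    also have "\<dots> \<le> Suc (Suc m) * 2 ^ Suc m" by (intro mult_le_mono) simp_all
    finally show ?thesis unfolding Suc .
  qed simp
  also have "\<dots> \<le> stable_bound (fm_code c (Conj p q))" by (rule stable_bound_less[OF n])
  finally have "card (F \<union> G) \<le> stable_bound (fm_code c (Conj p q))" .
  moreover have *: "\<forall>r\<in>subfms p \<union> subfms q. determines T i (F \<union> G) r"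
    using F(4) G(4) determines_mono[of T i F _ "F \<union> G"] determines_mono[of T i G _ "F \<union> G"] by blast
  moreover have "determines T i (F \<union> G) (Conj p q)"
    using * self_in_subfms by (intro determines_Conj) auto
  ultimately show ?case using F G by (intro exI[of _ "F \<union> G"]) auto
next
  case (Neg p)
  then obtain F where F: "finite F" "\<forall>U\<in>F. openin T U" "card F \<le> stable_bound (fm_code c p)"
      "\<forall>r\<in>subfms p. determines T i F r" by blast
  have "determines T i F (Neg p)"
    using F(4) self_in_subfms by (intro determines_Neg) auto
  moreover have "card F \<le> stable_bound (fm_code c (Neg p))"
    using F(3) stable_bound_mono[OF less_imp_le[OF fm_code_less(3)]] order_trans by blast
  ultimately show ?case using F by auto
next
  case (Box p)
  then obtain F where F: "finite F" "\<forall>U\<in>F. openin T U" "card F \<le> stable_bound (fm_code c p)"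
      "\<forall>r\<in>subfms p. determines T i F r" by blast
  define G where "G = (\<lambda>(s, U). T interior_of (- \<Inter>s \<union> U)) ` (Pow F \<times> F)"
  let ?b = "stable_bound (fm_code c p)"
  have G: "determines T i G (Box p)"
    unfolding G_def using F self_in_subfms by (intro determines_Box) auto
  have "card G \<le> 2 ^ card F * card F"
    unfolding G_def using card_image_le[of "Pow F \<times> F"] F(1)
    by (simp add: card_cartesian_product card_Pow)
  \<comment> \<open>Pays for keeping \<open>F\<close> beside the new opens: its members are counted
    by the extra summand \<open>2 ^ card F\<close> in
    \<open>Suc (card F) * 2 ^ card F\<close>.\<close>
  moreover have "card F < 2 ^ card F" by (rule less_exp)
  ultimately have "card (F \<union> G) \<le> Suc (card F) * 2 ^ card F"
    using card_Un_le[of F G] unfolding mult_Suc mult.commute[of "2 ^ card F"] by linarith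
  also have "\<dots> \<le> Suc ?b * 2 ^ ?b" using F(3) by (intro mult_le_mono power_increasing) simp_all
  also have "\<dots> \<le> stable_bound (fm_code c (Box p))" by (rule stable_bound_less[OF fm_code_less(4)])
  finally have "card (F \<union> G) \<le> stable_bound (fm_code c (Box p))" .
  moreover have "finite (F \<union> G)" "\<forall>U\<in>F \<union> G. openin T U" unfolding G_def using F by auto
  moreover have "\<forall>q\<in>subfms (Box p). determines T i (F \<union> G) q"
    using F(4) G determines_mono[of T i F _ "F \<union> G"] determines_mono[of T i G _ "F \<union> G"] by auto
  ultimately show ?case by blast
next
  case (Know p)
  then obtain F where F: "finite F" "\<forall>U\<in>F. openin T U" "card F \<le> stable_bound (fm_code c p)"
      "\<forall>r\<in>subfms p. determines T i F r" by blast
  define G where "G = (\<lambda>s. T interior_of {x. \<exists>V. openin T V \<and> x \<in> V \<and> {U\<in>F. V \<subseteq> U} = s \<and>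
    sat T i x V p}) ` Pow F"
  let ?b = "stable_bound (fm_code c p)"
  have G: "determines T i (F \<union> G) (Know p)"
    unfolding G_def using F self_in_subfms by (intro determines_Know) auto
  have "card G \<le> 2 ^ card F"
    unfolding G_def using card_image_le[of "Pow F"] F(1) by (simp add: card_Pow)
  moreover have "card F * 1 \<le> card F * 2 ^ card F" by (rule mult_le_mono2) simp
  ultimately have "card (F \<union> G) \<le> Suc (card F) * 2 ^ card F"
    using card_Un_le[of F G]
    unfolding mult_Suc by linarith
  also have "\<dots> \<le> Suc ?b * 2 ^ ?b" using F(3) by (intro mult_le_mono power_increasing) simp_all
  also have "\<dots> \<le> stable_bound (fm_code c (Know p))" by (rule stable_bound_less[OF fm_code_less(5)])
  finally have "card (F \<union> G) \<le> stable_bound (fm_code c (Know p))" .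
  moreover have "finite (F \<union> G)" "\<forall>U\<in>F \<union> G. openin T U" unfolding G_def using F by auto
  moreover have "\<forall>q\<in>subfms (Know p). determines T i (F \<union> G) q"
    using F(4) G determines_mono[of T i F _ "F \<union> G"] by auto
  ultimately show ?case by blast
qed

section \<open>Passage to a finite quotient\<close>

definition quotient_topology :: "'x topology \<Rightarrow> ('x \<Rightarrow> 'z) \<Rightarrow> 'z topology" where
  "quotient_topology T f =
     topology (\<lambda>S. S \<subseteq> f ` topspace T \<and> openin T {x\<in>topspace T. f x \<in> S})"

lemma openin_quotient_topology:
  "openin (quotient_topology T f) S \<longleftrightarrow>
    S \<subseteq> f ` topspace T \<and> openin T {x\<in>topspace T. f x \<in> S}"
proof -
  have "istopology (\<lambda>S. S \<subseteq> f ` topspace T \<and> openin T {x\<in>topspace T. f x \<in> S})"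
    unfolding istopology_def
  proof (intro conjI allI impI)
    fix S S'
    assume "S \<subseteq> f ` topspace T \<and> openin T {x\<in>topspace T. f x \<in> S}"
      "S' \<subseteq> f ` topspace T \<and> openin T {x\<in>topspace T. f x \<in> S'}"
    then have "openin T ({x\<in>topspace T. f x \<in> S} \<inter> {x\<in>topspace T. f x \<in> S'})" by auto
    moreover have "{x\<in>topspace T. f x \<in> S} \<inter> {x\<in>topspace T. f x \<in> S'} =
      {x\<in>topspace T. f x \<in> S \<inter> S'}" by auto
    ultimately show "openin T {x\<in>topspace T. f x \<in> S \<inter> S'}" by simp
  next
    fix K
    assume "\<forall>S\<in>K. S \<subseteq> f ` topspace T \<and> openin T {x\<in>topspace T. f x \<in> S}"
    then have "openin T (\<Union>S\<in>K. {x\<in>topspace T. f x \<in> S})" by (intro openin_Union) auto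
    moreover have "(\<Union>S\<in>K. {x\<in>topspace T. f x \<in> S}) = {x\<in>topspace T. f x \<in> \<Union>K}" by auto
    ultimately show "openin T {x\<in>topspace T. f x \<in> \<Union>K}" by simp
  qed auto
  then show ?thesis unfolding quotient_topology_def by (simp add: topology_inverse')
qed

lemma topspace_quotient_topology: "topspace (quotient_topology T f) = f ` topspace T"
proof
  show "topspace (quotient_topology T f) \<subseteq> f ` topspace T"
    using openin_topspace[of "quotient_topology T f"] unfolding openin_quotient_topology by blast
  have "{x\<in>topspace T. f x \<in> f ` topspace T} = topspace T" by auto
  then have "openin (quotient_topology T f) (f ` topspace T)"
    unfolding openin_quotient_topology by simp
  then show "f ` topspace T \<subseteq> topspace (quotient_topology T f)" by (rule openin_subset)
qed

text \<open>Opens of the quotient correspond to the opens of \<open>T\<close> that are unions of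
  fibres of \<open>f\<close>, so in the case of \<open>Box\<close> the space \<open>T\<close> has
  more opens to be tested than the quotient. The assumption on \<open>f\<close> makes every member
  of \<open>F\<close> a union of fibres; hence any open can be enlarged to one that is a union of
  fibres and has the same supersets in \<open>F\<close>, and \<open>determines\<close> says that
  this does not affect truth.\<close>

lemma sat_quotient_topology:
  assumes F: "finite F" "\<And>U. U \<in> F \<Longrightarrow> openin T U"
    and i: "\<And>a. i a \<subseteq> topspace T"
    and f: "\<And>U x y. U \<in> F \<Longrightarrow> x \<in> topspace T \<Longrightarrow> y \<in> topspace T \<Longrightarrow> f x = f y \<Longrightarrow> x \<in> U \<Longrightarrow> y \<in> U"
  shows "(\<forall>q\<in>subfms p. determines T i F q) \<Longrightarrow>
    (\<And>a x y. a \<in> set_fm p \<Longrightarrow> x \<in> i a \<Longrightarrow> y \<in> topspace T \<Longrightarrow> f x = f y \<Longrightarrow> y \<in> i a) \<Longrightarrow>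
    openin (quotient_topology T f) S \<Longrightarrow> x \<in> topspace T \<Longrightarrow> f x \<in> S \<Longrightarrow>
    sat T i x {x\<in>topspace T. f x \<in> S} p \<longleftrightarrow>
      sat (quotient_topology T f) (\<lambda>a. f ` i a) (f x) S p"
proof (induction p arbitrary: x S)
  case (Atom a)
  show ?case using Atom.prems(2)[of a _ x] Atom.prems(4) by fastforce
next
  case (Conj p q)
  have "sat T i x {x\<in>topspace T. f x \<in> S} p \<longleftrightarrow>
      sat (quotient_topology T f) (\<lambda>a. f ` i a) (f x) S p"
    by (rule Conj.IH(1)) (use Conj.prems in auto)
  moreover have "sat T i x {x\<in>topspace T. f x \<in> S} q \<longleftrightarrow>
      sat (quotient_topology T f) (\<lambda>a. f ` i a) (f x) S q"
    by (rule Conj.IH(2)) (use Conj.prems in auto)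
  ultimately show ?case by simp
next
  case (Neg p)
  have "sat T i x {x\<in>topspace T. f x \<in> S} p \<longleftrightarrow>
      sat (quotient_topology T f) (\<lambda>a. f ` i a) (f x) S p"
    by (rule Neg.IH) (use Neg.prems in auto)
  then show ?case by simp
next
  case (Know p)
  have *: "sat T i y {x\<in>topspace T. f x \<in> S} p \<longleftrightarrow>
      sat (quotient_topology T f) (\<lambda>a. f ` i a) (f y) S p" if "y \<in> topspace T" "f y \<in> S" for y
    by (rule Know.IH) (use Know.prems that in auto)
  have "(\<forall>z\<in>S. P z) \<longleftrightarrow> (\<forall>y\<in>topspace T. f y \<in> S \<longrightarrow> P (f y))" for P
    using Know.prems(3) unfolding openin_quotient_topology by blast
  then show ?case using * by (simp del: ball_simps) blast
next
  case (Box p)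
  let ?Q = "quotient_topology T f"
  let ?pre = "\<lambda>S. {x\<in>topspace T. f x \<in> S}"
  have IH: "sat T i x (?pre S') p \<longleftrightarrow> sat ?Q (\<lambda>a. f ` i a) (f x) S' p"
    if "openin ?Q S'" "f x \<in> S'" for S'
    by (rule Box.IH) (use Box.prems that in auto)
  have p: "determines T i F p" using Box.prems(1) self_in_subfms[of p] by auto
  show ?case
  proof
    assume sat: "sat T i x (?pre S) (Box p)"
    show "sat ?Q (\<lambda>a. f ` i a) (f x) S (Box p)"
      unfolding sat.simps
    proof (intro allI impI)
      fix S' assume S': "openin ?Q S' \<and> f x \<in> S' \<and> S' \<subseteq> S"
      then have "openin T (?pre S')" "x \<in> ?pre S'" "?pre S' \<subseteq> ?pre S"
        using Box.prems unfolding openin_quotient_topology by auto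
      then have "sat T i x (?pre S') p" using sat by simp
      then show "sat ?Q (\<lambda>a. f ` i a) (f x) S' p" using IH S' by blast
    qed
  next
    assume sat: "sat ?Q (\<lambda>a. f ` i a) (f x) S (Box p)"
    show "sat T i x (?pre S) (Box p)"
      unfolding sat.simps
    proof (intro allI impI)
      fix W assume W: "openin T W \<and> x \<in> W \<and> W \<subseteq> ?pre S"
      define s where "s = {U\<in>F. W \<subseteq> U}"
      \<comment> \<open>The enlargement of \<open>W\<close> within the preimage of \<open>S\<close>:
        cut down by every member of \<open>F\<close> that includes \<open>W\<close>, it is included
        in the same members of \<open>F\<close> as \<open>W\<close>.\<close>
      define W' where "W' = \<Inter>(insert (?pre S) s)"
      have fin: "finite s" and sF: "s \<subseteq> F" unfolding s_def using F by auto
      have W': "openin T W'" unfolding W'_def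
        by (rule openin_Inter)
          (use fin sF F Box.prems(3) in \<open>auto simp: openin_quotient_topology\<close>)
      have WW': "W \<subseteq> W'" using W unfolding W'_def s_def by auto
      have W'_eq: "W' = ?pre (f ` W')"
      proof
        show "W' \<subseteq> ?pre (f ` W')" unfolding W'_def by auto
        show "?pre (f ` W') \<subseteq> W'"
        proof
          fix y assume "y \<in> ?pre (f ` W')"
          then obtain z where z: "y \<in> topspace T" "z \<in> W'" "f y = f z" by auto
          then have "z \<in> topspace T" unfolding W'_def by auto
          then have "y \<in> U" if "U \<in> s" for U
            using f[of U z y] that sF z unfolding W'_def by auto
          then show "y \<in> W'" using z unfolding W'_def by auto
        qed
      qed
      have "f ` W' \<subseteq> f ` topspace T" unfolding W'_def by auto
      then have Q: "openin ?Q (f ` W')"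
        unfolding openin_quotient_topology using W' by (simp flip: W'_eq)
      have "f x \<in> f ` W'" "f ` W' \<subseteq> S" using W WW' unfolding W'_def by auto
      then have "sat ?Q (\<lambda>a. f ` i a) (f x) (f ` W') p" using sat Q by simp
      then have "sat T i x W' p" using IH[OF Q] \<open>f x \<in> f ` W'\<close> by (simp flip: W'_eq)
      moreover have "W \<subseteq> U \<longleftrightarrow> W' \<subseteq> U" if "U \<in> F" for U
        using that WW' unfolding W'_def s_def by blast
      ultimately show "sat T i x W p"
        using determinesD[OF p, of W W' x] W W' WW' by blast
    qed
  qed
qed

lemma finite_set_fm: "finite (set_fm p)"
  by (induction p) auto

text \<open>The points of the countermodel come from any large enough finite set \<open>Z\<close> of
  any type. Initial segments of \<open>nat\<close> give models that can be coded; finite subsets of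
  an infinite type bring countermodels back to that type.\<close>

lemma finite_model_property:
  fixes T :: "'x topology" and Z :: "'z set"
  assumes c: "inj c" and model: "topological_model tt ff T i" and invalid: "\<not> valid_in T i p"
    and Z: "finite Z" "model_bound (fm_code c p) \<le> card Z"
  shows "\<exists>(T' :: 'z topology) i'. topological_model tt ff T' i' \<and> topspace T' \<subseteq> Z \<and>
    \<not> valid_in T' i' p"
proof -
  obtain x V where V: "openin T V" "x \<in> V" "\<not> sat T i x V p"
    using invalid unfolding valid_in_def by blast
  have i: "i a \<subseteq> topspace T" "i tt = topspace T" "i ff = {}" for a
    using model unfolding topological_model_def by auto
  obtain F where F: "finite F" "\<And>U. U \<in> F \<Longrightarrow> openin T U"
      "card F \<le> stable_bound (fm_code c p)" "\<forall>q\<in>subfms p. determines T i F q"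
    using exists_determining_family by metis
  \<comment> \<open>All possible classes of points: a trace on \<open>F\<close> together with the
    atoms of \<open>p\<close> true there. The map \<open>h\<close> below renames them injectively
    into \<open>Z\<close>.\<close>
  define A where "A = Pow F \<times> Pow (set_fm p)"
  define g where "g x = ({U\<in>F. x \<in> U}, {a\<in>set_fm p. x \<in> i a})" for x
  have g: "g ` topspace T \<subseteq> A" unfolding g_def A_def by auto
  have "card (set_fm p) = card (c ` set_fm p)"
    using c by (metis card_image inj_on_subset subset_UNIV)
  also have "\<dots> \<le> card {..fm_code c p}"
    using atom_le_fm_code[of _ p c] by (intro card_mono) auto
  finally have "card F + card (set_fm p) \<le> stable_bound (fm_code c p) + Suc (fm_code c p)"
    using F(3) by simp
  then have "card A \<le> card Z"
    using Z(2) power_increasing[of "card F + card (set_fm p)" _ "2 :: nat"]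
    unfolding A_def model_bound_def card_cartesian_product card_Pow[OF F(1)]
      card_Pow[OF finite_set_fm] power_add[symmetric]
    by (meson one_le_numeral order_trans)
  moreover have "finite A" unfolding A_def using F(1) finite_set_fm by blast
  ultimately obtain h where h: "h ` A \<subseteq> Z" "inj_on h A"
    using card_le_inj[of A Z] Z(1) by blast
  define f where "f = h \<circ> g"
  have f: "g x = g y" if "f x = f y" "x \<in> topspace T" "y \<in> topspace T" for x y
    using that g h(2) unfolding f_def inj_on_def by auto
  have fF: "y \<in> U" if "U \<in> F" "x \<in> topspace T" "y \<in> topspace T" "f x = f y" "x \<in> U" for U x y
    using f[of x y] that unfolding g_def by auto
  have fi: "y \<in> i a" if "a \<in> set_fm p" "x \<in> i a" "y \<in> topspace T" "f x = f y" for a x y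
    using f[of x y] that i(1) unfolding g_def by auto
  let ?Q = "quotient_topology T f"
  let ?j = "\<lambda>a. f ` i a"
  define s where "s = {U\<in>F. V \<subseteq> U}"
  \<comment> \<open>\<open>V\<close> need not be a union of fibres of \<open>f\<close>, so the
    failure of \<open>p\<close> is first moved to the larger open \<open>W\<close>. Inserting
    \<open>topspace T\<close> matters when no member of \<open>F\<close> includes \<open>V\<close>:
    the empty intersection would be the whole type.\<close>
  define W where "W = \<Inter>(insert (topspace T) s)"
  have "finite s" "s \<subseteq> F" unfolding s_def using F by auto
  then have W: "openin T W" unfolding W_def
    by (intro openin_Inter) (use F in auto)
  have VW: "V \<subseteq> W" using openin_subset[OF V(1)] unfolding W_def s_def by auto
  then have xW: "x \<in> W" "x \<in> topspace T" using V unfolding W_def by auto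
  have "V \<subseteq> U \<longleftrightarrow> W \<subseteq> U" if "U \<in> F" for U
    using that VW unfolding W_def s_def by blast
  moreover have "determines T i F p" using F(4) self_in_subfms by blast
  ultimately have nsat: "\<not> sat T i x W p"
    using determinesD[of T i F p V W x] V W xW by blast
  have W_eq: "W = {x\<in>topspace T. f x \<in> f ` W}"
  proof
    show "W \<subseteq> {x\<in>topspace T. f x \<in> f ` W}" unfolding W_def by auto
    show "{x\<in>topspace T. f x \<in> f ` W} \<subseteq> W"
    proof
      fix y assume "y \<in> {x\<in>topspace T. f x \<in> f ` W}"
      then obtain z where z: "y \<in> topspace T" "z \<in> W" "f y = f z" by auto
      then have "z \<in> topspace T" unfolding W_def by auto
      then have "y \<in> U" if "U \<in> s" for U
        using fF[of U z y] that \<open>s \<subseteq> F\<close> z unfolding W_def by auto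
      then show "y \<in> W" using z unfolding W_def by auto
    qed
  qed
  have "f ` W \<subseteq> f ` topspace T" unfolding W_def by auto
  then have Q: "openin ?Q (f ` W)"
    unfolding openin_quotient_topology using W by (simp flip: W_eq)
  have "sat T i x {x\<in>topspace T. f x \<in> f ` W} p \<longleftrightarrow> sat ?Q ?j (f x) (f ` W) p"
    by (rule sat_quotient_topology[OF F(1,2) i(1) _ F(4) _ Q]) (use xW fF fi in blast)+
  then have "\<not> sat ?Q ?j (f x) (f ` W) p" using nsat by (simp flip: W_eq)
  then have "\<not> valid_in ?Q ?j p" unfolding valid_in_def using Q xW by blast
  moreover have "topological_model tt ff ?Q ?j"
    unfolding topological_model_def topspace_quotient_topology using i by auto
  moreover have "topspace ?Q \<subseteq> Z"
    unfolding topspace_quotient_topology f_def using g h(1) by auto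
  ultimately show ?thesis by blast
qed

section \<open>Coding finite models by numbers\<close>

lemma set_encode_less: "A \<subseteq> {..<k} \<Longrightarrow> set_encode A < 2 ^ k"
proof -
  assume "A \<subseteq> {..<k}"
  then have "set_encode A \<le> sum ((^) 2) {..<k}"
    unfolding set_encode_def by (intro sum_mono2) auto
  also have "\<dots> < 2 ^ k" by (induction k) auto
  finally show ?thesis .
qed

lemma set_decode_subset: "u < 2 ^ k \<Longrightarrow> set_decode u \<subseteq> {..<k}"
proof
  fix m assume u: "u < 2 ^ k" and m: "m \<in> set_decode u"
  show "m \<in> {..<k}"
  proof (rule ccontr)
    assume "m \<notin> {..<k}"
    then have "(2 :: nat) ^ k \<le> 2 ^ m" by (intro power_increasing) auto
    then have "u div 2 ^ m = 0" using u by (intro div_less) linarith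
    then show False using m by (simp add: set_decode_def)
  qed
qed

lemma prod_encode_mono: "a \<le> a' \<Longrightarrow> b \<le> b' \<Longrightarrow> prod_encode (a, b) \<le> prod_encode (a', b')"
proof -
  assume ab: "a \<le> a'" "b \<le> b'"
  have "mono triangle" unfolding mono_iff_le_Suc by simp
  then have "triangle (a + b) \<le> triangle (a' + b')" using ab by (auto dest: monoD[of triangle "a + b" "a' + b'"])
  then show ?thesis using ab by (simp add: prod_encode_def)
qed

lemma set_decode_encode_bounded: "A \<subseteq> {..k} \<Longrightarrow> set_decode (set_encode A) = A"
  using finite_subset by (intro set_encode_inverse) blast

section \<open>Recognising codes of formulae\<close>

lemma fm_code_inject: "inj c \<Longrightarrow> fm_code c p = fm_code c q \<Longrightarrow> p = q"
proof (induction p arbitrary: q)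
  case (Atom a)
  then show ?case by (cases q) (auto simp: inj_eq)
next
  case (Conj p1 p2)
  then show ?case by (cases q) auto
next
  case (Neg p)
  then show ?case by (cases q) auto
next
  case (Box p)
  then show ?case by (cases q) auto
next
  case (Know p)
  then show ?case by (cases q) auto
qed

text \<open>One unfolding of the recursion behind \<open>fm_code\<close>, with bounded witnesses:
  \<open>A\<close> is the set of atom positions, and \<open>B\<close> stands for the codes already
  recognised. The set of all codes is a fixed point.\<close>

definition fm_code_step :: "nat set \<Rightarrow> nat set \<Rightarrow> nat \<Rightarrow> bool" where
  "fm_code_step A B q \<longleftrightarrow>
     (\<exists>m\<le>q. q = prod_encode (0, m) \<and> m \<in> A) \<or>
     (\<exists>a\<le>q. \<exists>b\<le>q. q = prod_encode (1, prod_encode (a, b)) \<and> a \<in> B \<and> b \<in> B) \<or>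
     (\<exists>a\<le>q. (q = prod_encode (2, a) \<or> q = prod_encode (3, a) \<or> q = prod_encode (4, a)) \<and> a \<in> B)"

text \<open>By the positive tags, \<open>B\<close> is consulted only strictly below
  \<open>q\<close>. Fixed points therefore agree on every initial segment of the numbers.\<close>

lemma fm_code_step_mono:
  assumes step: "fm_code_step A B q" and BB': "\<And>a. a < q \<Longrightarrow> a \<in> B \<Longrightarrow> a \<in> B'"
  shows "fm_code_step A B' q"
proof -
  have q1: "a < q" "b < q" if "q = prod_encode (1, prod_encode (a, b))" for a b
    using that snd_less_prod_encode[of 1 "prod_encode (a, b)"]
      le_prod_encode_1[of a b] le_prod_encode_2[of b a] by auto
  have q2: "a < q" if "q = prod_encode (2, a) \<or> q = prod_encode (3, a) \<or> q = prod_encode (4, a)" for a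
    using that snd_less_prod_encode[of _ a] by auto
  consider (1) m where "m \<le> q" "q = prod_encode (0, m)" "m \<in> A"
    | (2) a b where "a \<le> q" "b \<le> q" "q = prod_encode (1, prod_encode (a, b))" "a \<in> B" "b \<in> B"
    | (3) a where "a \<le> q" "a \<in> B"
      "q = prod_encode (2, a) \<or> q = prod_encode (3, a) \<or> q = prod_encode (4, a)"
    using step unfolding fm_code_step_def by metis
  then show ?thesis
  proof cases
    case 1
    then show ?thesis unfolding fm_code_step_def by metis
  next
    case 2
    then have "a \<in> B'" "b \<in> B'" using q1 BB' by simp_all
    with 2 show ?thesis unfolding fm_code_step_def by metis
  next
    case 3
    then have "a \<in> B'" using q2 BB' by simp
    with 3 show ?thesis unfolding fm_code_step_def by metis
  qed
qed

lemma fm_code_step_cong: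
  "(\<And>a. a < q \<Longrightarrow> a \<in> B \<longleftrightarrow> a \<in> B') \<Longrightarrow> fm_code_step A B q \<longleftrightarrow> fm_code_step A B' q"
  using fm_code_step_mono[of A B q B'] fm_code_step_mono[of A B' q B] by metis

text \<open>Replaces course-of-values recursion: the fixed point equation is checked for the set
  coded by \<open>G\<close>, and by strong induction this pins down its elements up to
  \<open>n\<close>.\<close>

definition formula_table :: "nat set \<Rightarrow> nat \<Rightarrow> nat \<Rightarrow> bool" where
  "formula_table A n G \<longleftrightarrow>
     (\<forall>q\<le>n. q \<in> set_decode G \<longleftrightarrow> fm_code_step A (set_decode G) q)"

lemma computable_pred_formula_table:
  assumes A: "decidable A" and "computable k f" "computable k g"
  shows "computable_pred k (\<lambda>xs. formula_table A (f xs) (g xs))"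
proof (rule computable_pred_comp2[where P = "formula_table A", OF _ assms(2,3)])
  show "computable_pred (Suc (Suc 0)) (\<lambda>xs. formula_table A (hd xs) (hd (tl xs)))"
    unfolding formula_table_def fm_code_step_def
    by (intro computable_intros computable_pred_in_set_decode computable_pred_decidable[OF A])
qed

lemma range_fm_code_iff:
  "q \<in> range (fm_code c) \<longleftrightarrow> fm_code_step (range c) (range (fm_code c)) q"
proof
  assume "q \<in> range (fm_code c)"
  then obtain p where p: "q = fm_code c p" by blast
  show "fm_code_step (range c) (range (fm_code c)) q"
  proof (cases p)
    case (Atom a)
    have "c a \<le> q" "q = prod_encode (0, c a)"
      using le_prod_encode_2[of "c a" 0] p Atom by simp_all
    then show ?thesis unfolding fm_code_step_def by blast
  next
    case (Conj p1 p2)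
    have "fm_code c p1 \<le> q" "fm_code c p2 \<le> q"
      "q = prod_encode (1, prod_encode (fm_code c p1, fm_code c p2))"
      using fm_code_less(1)[of c p1 p2] fm_code_less(2)[of c p2 p1] p Conj by simp_all
    then show ?thesis unfolding fm_code_step_def by blast
  next
    case (Neg p1)
    have "fm_code c p1 \<le> q" "q = prod_encode (2, fm_code c p1)"
      using fm_code_less(3)[of c p1] p Neg by simp_all
    then show ?thesis unfolding fm_code_step_def by blast
  next
    case (Box p1)
    have "fm_code c p1 \<le> q" "q = prod_encode (3, fm_code c p1)"
      using fm_code_less(4)[of c p1] p Box by simp_all
    then show ?thesis unfolding fm_code_step_def by blast
  next
    case (Know p1)
    have "fm_code c p1 \<le> q" "q = prod_encode (4, fm_code c p1)"
      using fm_code_less(5)[of c p1] p Know by simp_all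
    then show ?thesis unfolding fm_code_step_def by blast
  qed
next
  assume "fm_code_step (range c) (range (fm_code c)) q"
  then show "q \<in> range (fm_code c)"
    unfolding fm_code_step_def by (elim disjE exE conjE rangeE) (simp_all only: fm_code.simps[symmetric] rangeI)
qed

lemma formula_table_iff:
  assumes G: "formula_table (range c) n G" and "q \<le> n"
  shows "q \<in> set_decode G \<longleftrightarrow> q \<in> range (fm_code c)"
  using \<open>q \<le> n\<close>
proof (induction q rule: less_induct)
  case (less q)
  have "fm_code_step (range c) (set_decode G) q \<longleftrightarrow>
      fm_code_step (range c) (range (fm_code c)) q"
    using less by (intro fm_code_step_cong) simp
  then show ?case
    using G less.prems range_fm_code_iff[of q c] unfolding formula_table_def by simp
qed

lemma exists_formula_table:
  "\<exists>G<2 ^ Suc n. formula_table (range c) n G"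
proof -
  let ?A = "range (fm_code c) \<inter> {..n}"
  have dec: "set_decode (set_encode ?A) = ?A" by (rule set_decode_encode_bounded) auto
  have "set_encode ?A < 2 ^ Suc n" by (intro set_encode_less) auto
  moreover have "formula_table (range c) n (set_encode ?A)"
    unfolding formula_table_def dec
  proof (intro allI impI)
    fix q assume q: "q \<le> n"
    then have "fm_code_step (range c) ?A q \<longleftrightarrow> fm_code_step (range c) (range (fm_code c)) q"
      by (intro fm_code_step_cong) simp
    then show "q \<in> ?A \<longleftrightarrow> fm_code_step (range c) ?A q"
      using q range_fm_code_iff[of q c] by simp
  qed
  ultimately show ?thesis by blast
qed

text \<open>Finite spaces are coded by relations: the points are the reflexive elements, the opens the
  sets of points closed under the relation.\<close>

definition rel_topology :: "nat \<Rightarrow> nat set \<Rightarrow> nat topology" where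
  "rel_topology M r = topology (\<lambda>U. U \<subseteq> {x. x < M \<and> prod_encode (x, x) \<in> r} \<and>
     (\<forall>x\<in>U. \<forall>y<M. prod_encode (y, y) \<in> r \<and> prod_encode (x, y) \<in> r \<longrightarrow> y \<in> U))"

text \<open>The sets closed under an arbitrary relation form a topology, so every number codes a
  space and the quantifier over \<open>R\<close> can run over all numbers below its bound.\<close>

lemma openin_rel_topology:
  "openin (rel_topology M r) U \<longleftrightarrow> U \<subseteq> {x. x < M \<and> prod_encode (x, x) \<in> r} \<and>
     (\<forall>x\<in>U. \<forall>y<M. prod_encode (y, y) \<in> r \<and> prod_encode (x, y) \<in> r \<longrightarrow> y \<in> U)"
proof -
  have "istopology (\<lambda>U. U \<subseteq> {x. x < M \<and> prod_encode (x, x) \<in> r} \<and>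
     (\<forall>x\<in>U. \<forall>y<M. prod_encode (y, y) \<in> r \<and> prod_encode (x, y) \<in> r \<longrightarrow> y \<in> U))"
    unfolding istopology_def by blast
  then show ?thesis unfolding rel_topology_def by (simp add: topology_inverse')
qed

lemma topspace_rel_topology:
  "topspace (rel_topology M r) = {x. x < M \<and> prod_encode (x, x) \<in> r}"
  unfolding topspace_def openin_rel_topology by blast

text \<open>In a finite space each point has a least open neighbourhood, the intersection of its
  finitely many open neighbourhoods. So the opens are the sets closed under the specialization
  preorder \<open>r\<close>, whose reflexive pairs mark exactly the points.\<close>

lemma rel_topology_cover:
  fixes T :: "nat topology"
  assumes T: "topspace T \<subseteq> {..<M}"
  shows "\<exists>R<2 ^ Suc (prod_encode (M, M)). rel_topology M (set_decode R) = T"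
proof -
  define r where "r = {prod_encode (x, y) | x y. x \<in> topspace T \<and> y \<in> topspace T \<and>
    (\<forall>U. openin T U \<longrightarrow> x \<in> U \<longrightarrow> y \<in> U)}"
  have r: "prod_encode (x, y) \<in> r \<longleftrightarrow> x \<in> topspace T \<and> y \<in> topspace T \<and>
    (\<forall>U. openin T U \<longrightarrow> x \<in> U \<longrightarrow> y \<in> U)" for x y unfolding r_def by auto
  have bound: "r \<subseteq> {..prod_encode (M, M)}"
  proof
    fix k assume "k \<in> r"
    then obtain x y where "k = prod_encode (x, y)" "x \<in> topspace T" "y \<in> topspace T"
      unfolding r_def by blast
    moreover from this have "x \<le> M" "y \<le> M" using T by auto
    ultimately show "k \<in> {..prod_encode (M, M)}" using prod_encode_mono by simp
  qed
  have fin: "finite {V. openin T V \<and> x \<in> V}" for x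
    by (rule finite_subset[of _ "Pow {..<M}"]) (use T in \<open>auto dest: openin_subset\<close>)
  have "openin (rel_topology M r) U \<longleftrightarrow> openin T U" for U
  proof
    assume U: "openin (rel_topology M r) U"
    show "openin T U"
    proof (subst openin_subopen, intro ballI)
      fix x assume x: "x \<in> U"
      have xT: "x \<in> topspace T" using U x unfolding openin_rel_topology r by auto
      let ?V = "\<Inter>{V. openin T V \<and> x \<in> V}"
      have "openin T ?V" by (rule openin_Inter) (use fin xT in auto)
      moreover have "?V \<subseteq> U"
      proof
        fix y assume y: "y \<in> ?V"
        then have "y \<in> topspace T" using xT by auto
        then have "prod_encode (x, y) \<in> r" "prod_encode (y, y) \<in> r" "y < M"
          using y xT T unfolding r by auto
        then show "y \<in> U" using U x unfolding openin_rel_topology by blast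
      qed
      ultimately show "\<exists>V. openin T V \<and> x \<in> V \<and> V \<subseteq> U" by blast
    qed
  next
    assume "openin T U"
    moreover from this have "U \<subseteq> topspace T" by (rule openin_subset)
    ultimately show "openin (rel_topology M r) U"
      unfolding openin_rel_topology r using T by blast
  qed
  then have "rel_topology M r = T" unfolding topology_eq by blast
  moreover have "set_encode r < 2 ^ Suc (prod_encode (M, M))"
    using bound by (intro set_encode_less) auto
  ultimately show ?thesis using set_decode_encode_bounded[OF bound] by metis
qed

section \<open>Opens and valuations as numbers\<close>

definition rel_open :: "nat \<Rightarrow> nat \<Rightarrow> nat \<Rightarrow> bool" where
  "rel_open M R u \<longleftrightarrow> u < 2 ^ M \<and> (\<forall>x<M. x \<in> set_decode u \<longrightarrow>
     prod_encode (x, x) \<in> set_decode R \<and>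
     (\<forall>y<M. prod_encode (y, y) \<in> set_decode R \<and> prod_encode (x, y) \<in> set_decode R \<longrightarrow>
       y \<in> set_decode u))"

lemma computable_pred_rel_open:
  assumes "computable k f" "computable k g" "computable k h"
  shows "computable_pred k (\<lambda>xs. rel_open (f xs) (g xs) (h xs))"
proof (rule computable_pred_comp3[where P = rel_open, OF _ assms])
  show "computable_pred (Suc (Suc (Suc 0)))
      (\<lambda>xs. rel_open (hd xs) (hd (tl xs)) (hd (tl (tl xs))))"
    unfolding rel_open_def by (intro computable_intros computable_pred_in_set_decode)
qed

lemma rel_open_iff:
  "rel_open M R u \<longleftrightarrow> openin (rel_topology M (set_decode R)) (set_decode u)"
proof
  assume "rel_open M R u"
  then show "openin (rel_topology M (set_decode R)) (set_decode u)"
    unfolding rel_open_def openin_rel_topology using set_decode_subset[of u M] by blast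
next
  assume u: "openin (rel_topology M (set_decode R)) (set_decode u)"
  then have "set_encode (set_decode u) < 2 ^ M"
    unfolding openin_rel_topology by (intro set_encode_less) auto
  with u show "rel_open M R u"
    unfolding rel_open_def openin_rel_topology by (simp add: set_decode_inverse) blast
qed

lemma openin_rel_topologyE:
  assumes "openin (rel_topology M (set_decode R)) U"
  obtains u where "U = set_decode u" "u < 2 ^ M" "rel_open M R u"
proof -
  have "U \<subseteq> {..<M}" using assms unfolding openin_rel_topology by auto
  then have U: "set_decode (set_encode U) = U"
    using finite_subset by (intro set_encode_inverse) blast
  then have ro: "rel_open M R (set_encode U)" using assms unfolding rel_open_iff by simp
  then have "set_encode U < 2 ^ M" unfolding rel_open_def by blast
  then show thesis by (rule that[OF U[symmetric] _ ro])
qed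

text \<open>The values at \<open>tt\<close> and \<open>ff\<close> are built in and all others are
  cut down to the carrier, so that for distinct \<open>tt\<close> and \<open>ff\<close> every
  \<open>s\<close> yields a topological model.\<close>

definition coded_valuation :: "('a \<Rightarrow> nat) \<Rightarrow> 'a \<Rightarrow> 'a \<Rightarrow> nat \<Rightarrow> nat set \<Rightarrow> nat set \<Rightarrow> 'a \<Rightarrow> nat set"
  where "coded_valuation c tt ff M r s a =
    {x. x < M \<and> prod_encode (x, x) \<in> r \<and> (a = tt \<or> a \<noteq> ff \<and> prod_encode (c a, x) \<in> s)}"

lemma topological_model_coded:
  "tt \<noteq> ff \<Longrightarrow>
    topological_model tt ff (rel_topology M r) (coded_valuation c tt ff M r s)"
  unfolding topological_model_def topspace_rel_topology coded_valuation_def by auto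

lemma sat_cong_valuation:
  "(\<And>a. a \<in> set_fm p \<Longrightarrow> i a = j a) \<Longrightarrow> sat T i x U p \<longleftrightarrow> sat T j x U p"
  by (induction p arbitrary: x U) auto

text \<open>Only the values at the finitely many atoms of \<open>p\<close> are stored. The coded
  valuation may differ from \<open>i\<close> elsewhere, so the conclusion is about satisfaction of
  \<open>p\<close>.\<close>

lemma coded_model_cover:
  fixes T :: "nat topology"
  assumes c: "inj c" and T: "topspace T \<subseteq> {..<M}" and model: "topological_model tt ff T i"
  shows "\<exists>R<2 ^ Suc (prod_encode (M, M)). \<exists>I<2 ^ Suc (prod_encode (fm_code c p, M)).
    rel_topology M (set_decode R) = T \<and>
    (\<forall>x U. sat T (coded_valuation c tt ff M (set_decode R) (set_decode I)) x U p
       \<longleftrightarrow> sat T i x U p)"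
proof -
  obtain R where R: "R < 2 ^ Suc (prod_encode (M, M))" "rel_topology M (set_decode R) = T"
    using rel_topology_cover[OF T] by blast
  define s where "s = {prod_encode (c a, x) | a x. a \<in> set_fm p \<and> x \<in> i a}"
  have i: "i a \<subseteq> topspace T" "i tt = topspace T" "i ff = {}" for a
    using model unfolding topological_model_def by auto
  have "prod_encode (c a, x) \<le> prod_encode (fm_code c p, M)" if "a \<in> set_fm p" "x \<in> i a" for a x
    using atom_le_fm_code[of a p c] i(1)[of a] that T by (intro prod_encode_mono) auto
  then have bound: "s \<subseteq> {..prod_encode (fm_code c p, M)}" unfolding s_def by auto
  have "coded_valuation c tt ff M (set_decode R) s a = i a" if "a \<in> set_fm p" for a
  proof -
    have "x < M \<and> prod_encode (x, x) \<in> set_decode R \<longleftrightarrow> x \<in> topspace T" for x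
      using R(2) topspace_rel_topology[of M "set_decode R"] by auto
    moreover have "prod_encode (c a, x) \<in> s \<longleftrightarrow> x \<in> i a" for x
      unfolding s_def using c that by (auto simp: inj_eq)
    ultimately show ?thesis
      unfolding coded_valuation_def using i(1)[of a] i(2,3) by auto
  qed
  moreover have "set_encode s < 2 ^ Suc (prod_encode (fm_code c p, M))"
    using bound by (intro set_encode_less) auto
  moreover have "set_decode (set_encode s) = s" by (rule set_decode_encode_bounded[OF bound])
  ultimately show ?thesis
    using R sat_cong_valuation[of p "coded_valuation c tt ff M (set_decode R) s" i T] by metis
qed

section \<open>Truth tables\<close>

abbreviation entry :: "nat \<Rightarrow> nat \<Rightarrow> nat \<Rightarrow> nat" where
  "entry q x u \<equiv> prod_encode (q, prod_encode (x, u))"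

text \<open>\<open>tn\<close> and \<open>fn\<close> are the positions of the two distinguished atoms, \<open>I\<close> codes the valuation.\<close>

definition truth_clause ::
  "nat \<Rightarrow> nat \<Rightarrow> nat \<Rightarrow> nat \<Rightarrow> nat \<Rightarrow> nat \<Rightarrow> nat \<Rightarrow> nat \<Rightarrow> nat \<Rightarrow> bool" where
  "truth_clause M tn fn R I S q u x \<longleftrightarrow>
     (\<forall>m\<le>q. q = prod_encode (0, m) \<longrightarrow>
       (entry q x u \<in> set_decode S \<longleftrightarrow>
         m = tn \<or> \<not> m = fn \<and> prod_encode (m, x) \<in> set_decode I)) \<and>
     (\<forall>a\<le>q. \<forall>b\<le>q. q = prod_encode (1, prod_encode (a, b)) \<longrightarrow>
       (entry q x u \<in> set_decode S \<longleftrightarrow>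
         entry a x u \<in> set_decode S \<and> entry b x u \<in> set_decode S)) \<and>
     (\<forall>a\<le>q. q = prod_encode (2, a) \<longrightarrow>
       (entry q x u \<in> set_decode S \<longleftrightarrow> \<not> entry a x u \<in> set_decode S)) \<and>
     (\<forall>a\<le>q. q = prod_encode (3, a) \<longrightarrow>
       (entry q x u \<in> set_decode S \<longleftrightarrow>
         (\<forall>v<2 ^ M. rel_open M R v \<and> x \<in> set_decode v \<and>
            (\<forall>y<M. y \<in> set_decode v \<longrightarrow> y \<in> set_decode u) \<longrightarrow> entry a x v \<in> set_decode S))) \<and>
     (\<forall>a\<le>q. q = prod_encode (4, a) \<longrightarrow>
       (entry q x u \<in> set_decode S \<longleftrightarrow>
         (\<forall>y<M. y \<in> set_decode u \<longrightarrow> entry a y u \<in> set_decode S)))"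

text \<open>Only entries for recognised codes up to \<open>n\<close>, opens and their elements are
  constrained; all other bits of \<open>S\<close> are arbitrary.\<close>

definition truth_table ::
  "nat \<Rightarrow> nat \<Rightarrow> nat \<Rightarrow> nat \<Rightarrow> nat \<Rightarrow> nat \<Rightarrow> nat \<Rightarrow> nat \<Rightarrow> bool" where
  "truth_table n M tn fn R I G S \<longleftrightarrow>
     (\<forall>q\<le>n. q \<in> set_decode G \<longrightarrow> (\<forall>u<2 ^ M. rel_open M R u \<longrightarrow>
       (\<forall>x<M. x \<in> set_decode u \<longrightarrow> truth_clause M tn fn R I S q u x)))"

text \<open>The conjunct \<open>n \<in> set_decode G\<close> rejects numbers that code no formula.
  The bounds on \<open>R\<close>, \<open>I\<close> and \<open>S\<close> are those obtained in
  \<open>rel_topology_cover\<close>, \<open>coded_model_cover\<close> and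
  \<open>exists_truth_table\<close>.\<close>

definition all_models_satisfy :: "nat set \<Rightarrow> nat \<Rightarrow> nat \<Rightarrow> nat \<Rightarrow> bool" where
  "all_models_satisfy A tn fn n \<longleftrightarrow>
     (\<exists>G<2 ^ Suc n. formula_table A n G \<and> n \<in> set_decode G \<and>
       (\<forall>R<2 ^ Suc (prod_encode (model_bound n, model_bound n)).
        \<forall>I<2 ^ Suc (prod_encode (n, model_bound n)).
        \<forall>S<2 ^ Suc (entry n (model_bound n) (2 ^ model_bound n)).
          truth_table n (model_bound n) tn fn R I G S \<longrightarrow>
          (\<forall>u<2 ^ model_bound n. rel_open (model_bound n) R u \<longrightarrow>
            (\<forall>x<model_bound n. x \<in> set_decode u \<longrightarrow> entry n x u \<in> set_decode S))))"

lemma decidable_all_models_satisfy: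
  assumes "decidable A" shows "decidable {n. all_models_satisfy A tn fn n}"
  by (rule decidable_if_computable_pred,
    unfold all_models_satisfy_def truth_table_def truth_clause_def,
    intro computable_intros computable_model_bound computable_pred_in_set_decode
      computable_pred_rel_open computable_pred_formula_table[OF assms])

text \<open>At the code of a formula all conjuncts but one are vacuous because the tags differ; in
  the remaining one the bounded witnesses are fixed by injectivity of the pairing and within range
  since components have smaller codes.\<close>

lemma truth_clause_fm_code:
  "truth_clause M tn fn R I S (fm_code c (Atom a)) u x \<longleftrightarrow>
    (entry (fm_code c (Atom a)) x u \<in> set_decode S \<longleftrightarrow>
       c a = tn \<or> \<not> c a = fn \<and> prod_encode (c a, x) \<in> set_decode I)"
  "truth_clause M tn fn R I S (fm_code c (Conj p q)) u x \<longleftrightarrow>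
    (entry (fm_code c (Conj p q)) x u \<in> set_decode S \<longleftrightarrow>
       entry (fm_code c p) x u \<in> set_decode S \<and> entry (fm_code c q) x u \<in> set_decode S)"
  "truth_clause M tn fn R I S (fm_code c (Neg p)) u x \<longleftrightarrow>
    (entry (fm_code c (Neg p)) x u \<in> set_decode S \<longleftrightarrow>
       \<not> entry (fm_code c p) x u \<in> set_decode S)"
  "truth_clause M tn fn R I S (fm_code c (Box p)) u x \<longleftrightarrow>
    (entry (fm_code c (Box p)) x u \<in> set_decode S \<longleftrightarrow>
       (\<forall>v<2 ^ M. rel_open M R v \<and> x \<in> set_decode v \<and>
          (\<forall>y<M. y \<in> set_decode v \<longrightarrow> y \<in> set_decode u) \<longrightarrow>
          entry (fm_code c p) x v \<in> set_decode S))"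
  "truth_clause M tn fn R I S (fm_code c (Know p)) u x \<longleftrightarrow>
    (entry (fm_code c (Know p)) x u \<in> set_decode S \<longleftrightarrow>
       (\<forall>y<M. y \<in> set_decode u \<longrightarrow> entry (fm_code c p) y u \<in> set_decode S))"
proof -
  have *: "(\<forall>m\<le>q. b = m \<longrightarrow> P m) \<longleftrightarrow> P b" if "b \<le> q" for b q :: nat and P using that by blast
  have **: "(\<forall>m\<le>q. \<forall>m'\<le>q. b = m \<and> b' = m' \<longrightarrow> P m m') \<longleftrightarrow> P b b'"
    if "b \<le> q" "b' \<le> q" for b b' q :: nat and P using that by blast
  note less = fm_code_less[of c, THEN less_imp_le, unfolded fm_code.simps]
  show "truth_clause M tn fn R I S (fm_code c (Atom a)) u x \<longleftrightarrow>
      (entry (fm_code c (Atom a)) x u \<in> set_decode S \<longleftrightarrow>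
       c a = tn \<or> \<not> c a = fn \<and> prod_encode (c a, x) \<in> set_decode I)"
    unfolding truth_clause_def fm_code.simps by (simp add: prod_encode_eq * le_prod_encode_2)
  show "truth_clause M tn fn R I S (fm_code c (Conj p q)) u x \<longleftrightarrow>
    (entry (fm_code c (Conj p q)) x u \<in> set_decode S \<longleftrightarrow>
       entry (fm_code c p) x u \<in> set_decode S \<and> entry (fm_code c q) x u \<in> set_decode S)"
    unfolding truth_clause_def fm_code.simps using less(1)[of p q] less(2)[of q p]
    by (simp add: prod_encode_eq **)
  show "truth_clause M tn fn R I S (fm_code c (Neg p)) u x \<longleftrightarrow>
    (entry (fm_code c (Neg p)) x u \<in> set_decode S \<longleftrightarrow>
       \<not> entry (fm_code c p) x u \<in> set_decode S)"
    unfolding truth_clause_def fm_code.simps using less(3)[of p] by (simp add: prod_encode_eq *)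
  show "truth_clause M tn fn R I S (fm_code c (Box p)) u x \<longleftrightarrow>
    (entry (fm_code c (Box p)) x u \<in> set_decode S \<longleftrightarrow>
       (\<forall>v<2 ^ M. rel_open M R v \<and> x \<in> set_decode v \<and>
          (\<forall>y<M. y \<in> set_decode v \<longrightarrow> y \<in> set_decode u) \<longrightarrow>
          entry (fm_code c p) x v \<in> set_decode S))"
    unfolding truth_clause_def fm_code.simps using less(4)[of p] by (simp add: prod_encode_eq *)
  show "truth_clause M tn fn R I S (fm_code c (Know p)) u x \<longleftrightarrow>
    (entry (fm_code c (Know p)) x u \<in> set_decode S \<longleftrightarrow>
       (\<forall>y<M. y \<in> set_decode u \<longrightarrow> entry (fm_code c p) y u \<in> set_decode S))"
    unfolding truth_clause_def fm_code.simps using less(5)[of p] by (simp add: prod_encode_eq *)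
qed

section \<open>Satisfaction in coded models and correctness of truth tables\<close>

lemma rel_openD: "rel_open M R u \<Longrightarrow> u < 2 ^ M"
  unfolding rel_open_def by blast

lemma rel_open_mem_less: "rel_open M R u \<Longrightarrow> x \<in> set_decode u \<Longrightarrow> x < M"
  using set_decode_subset[OF rel_openD] by blast

lemma sat_coded_Atom:
  assumes "inj c" "rel_open M R u" "x \<in> set_decode u"
  shows "sat T (coded_valuation c tt ff M (set_decode R) (set_decode I)) x U (Atom a) \<longleftrightarrow>
    c a = c tt \<or> \<not> c a = c ff \<and> prod_encode (c a, x) \<in> set_decode I"
proof -
  have "prod_encode (x, x) \<in> set_decode R" "x < M"
    using assms(2,3) rel_open_mem_less[OF assms(2,3)] unfolding rel_open_def by blast+
  then show ?thesis using assms(1) by (simp add: coded_valuation_def inj_eq)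
qed

lemma sat_coded_Box:
  assumes "rel_open M R u"
  shows "sat (rel_topology M (set_decode R)) i x (set_decode u) (Box p) \<longleftrightarrow>
    (\<forall>v<2 ^ M. rel_open M R v \<and> x \<in> set_decode v \<and>
      (\<forall>y<M. y \<in> set_decode v \<longrightarrow> y \<in> set_decode u) \<longrightarrow>
      sat (rel_topology M (set_decode R)) i x (set_decode v) p)"
    (is "_ \<longleftrightarrow> ?R")
proof
  assume sat: "sat (rel_topology M (set_decode R)) i x (set_decode u) (Box p)"
  show ?R
  proof (intro allI impI)
    fix v
    assume v: "rel_open M R v \<and> x \<in> set_decode v \<and>
      (\<forall>y<M. y \<in> set_decode v \<longrightarrow> y \<in> set_decode u)"
    then have "set_decode v \<subseteq> set_decode u" using rel_open_mem_less by blast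
    then show "sat (rel_topology M (set_decode R)) i x (set_decode v) p"
      using sat v unfolding rel_open_iff by simp
  qed
next
  assume R: ?R
  show "sat (rel_topology M (set_decode R)) i x (set_decode u) (Box p)"
    unfolding sat.simps
  proof (intro allI impI)
    fix V assume V: "openin (rel_topology M (set_decode R)) V \<and> x \<in> V \<and> V \<subseteq> set_decode u"
    then obtain v where "V = set_decode v" "v < 2 ^ M" "rel_open M R v"
      by (auto elim: openin_rel_topologyE)
    then show "sat (rel_topology M (set_decode R)) i x V p" using R V by blast
  qed
qed

lemma sat_coded_Know:
  "rel_open M R u \<Longrightarrow> sat T i x (set_decode u) (Know p) \<longleftrightarrow>
    (\<forall>y<M. y \<in> set_decode u \<longrightarrow> sat T i y (set_decode u) p)"
  using rel_open_mem_less by auto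

text \<open>Local correctness forces the right values: each clause reduces an entry to entries of
  immediate subformulae, whose codes are again at most \<open>n\<close>, so induction on
  \<open>p\<close> applies.\<close>

lemma truth_table_sat:
  assumes c: "inj c"
    and G: "\<And>q. q \<le> n \<Longrightarrow> q \<in> set_decode G \<longleftrightarrow> q \<in> range (fm_code c)"
    and S: "truth_table n M (c tt) (c ff) R I G S"
  shows "fm_code c p \<le> n \<Longrightarrow> rel_open M R u \<Longrightarrow> x \<in> set_decode u \<Longrightarrow>
    entry (fm_code c p) x u \<in> set_decode S \<longleftrightarrow>
      sat (rel_topology M (set_decode R)) (coded_valuation c tt ff M (set_decode R) (set_decode I))
        x (set_decode u) p"
proof (induction p arbitrary: u x)
  case (Atom a)
  note clause = S[unfolded truth_table_def, rule_format, OF Atom.prems(1) _ _ Atom.prems(2)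
      rel_open_mem_less[OF Atom.prems(2,3)] Atom.prems(3), unfolded truth_clause_fm_code]
  have "entry (fm_code c (Atom a)) x u \<in> set_decode S \<longleftrightarrow>
      c a = c tt \<or> \<not> c a = c ff \<and> prod_encode (c a, x) \<in> set_decode I"
    by (rule clause) (use G Atom.prems rel_openD in blast)+
  then show ?case unfolding sat_coded_Atom[OF c Atom.prems(2,3)] .
next
  case (Conj p q)
  note clause = S[unfolded truth_table_def, rule_format, OF Conj.prems(1) _ _ Conj.prems(2)
      rel_open_mem_less[OF Conj.prems(2,3)] Conj.prems(3), unfolded truth_clause_fm_code]
  have "entry (fm_code c (Conj p q)) x u \<in> set_decode S \<longleftrightarrow>
      entry (fm_code c p) x u \<in> set_decode S \<and> entry (fm_code c q) x u \<in> set_decode S"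
    by (rule clause) (use G Conj.prems rel_openD in blast)+
  moreover have "fm_code c p \<le> n" "fm_code c q \<le> n"
    using Conj.prems(1) fm_code_less(1)[of c p q] fm_code_less(2)[of c q p] by linarith+
  ultimately show ?case using Conj.IH Conj.prems(2,3) by simp
next
  case (Neg p)
  note clause = S[unfolded truth_table_def, rule_format, OF Neg.prems(1) _ _ Neg.prems(2)
      rel_open_mem_less[OF Neg.prems(2,3)] Neg.prems(3), unfolded truth_clause_fm_code]
  have "entry (fm_code c (Neg p)) x u \<in> set_decode S \<longleftrightarrow>
      \<not> entry (fm_code c p) x u \<in> set_decode S"
    by (rule clause) (use G Neg.prems rel_openD in blast)+
  moreover have "fm_code c p \<le> n" using Neg.prems(1) fm_code_less(3)[of c p] by linarith
  ultimately show ?case using Neg.IH Neg.prems(2,3) by simp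
next
  case (Box p)
  note clause = S[unfolded truth_table_def, rule_format, OF Box.prems(1) _ _ Box.prems(2)
      rel_open_mem_less[OF Box.prems(2,3)] Box.prems(3), unfolded truth_clause_fm_code]
  have "entry (fm_code c (Box p)) x u \<in> set_decode S \<longleftrightarrow>
      (\<forall>v<2 ^ M. rel_open M R v \<and> x \<in> set_decode v \<and>
        (\<forall>y<M. y \<in> set_decode v \<longrightarrow> y \<in> set_decode u) \<longrightarrow>
        entry (fm_code c p) x v \<in> set_decode S)"
    by (rule clause) (use G Box.prems rel_openD in blast)+
  moreover have "fm_code c p \<le> n" using Box.prems(1) fm_code_less(4)[of c p] by linarith
  ultimately show ?case unfolding sat_coded_Box[OF Box.prems(2)] using Box.IH by metis
next
  case (Know p)
  note clause = S[unfolded truth_table_def, rule_format, OF Know.prems(1) _ _ Know.prems(2)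
      rel_open_mem_less[OF Know.prems(2,3)] Know.prems(3), unfolded truth_clause_fm_code]
  have "entry (fm_code c (Know p)) x u \<in> set_decode S \<longleftrightarrow>
      (\<forall>y<M. y \<in> set_decode u \<longrightarrow> entry (fm_code c p) y u \<in> set_decode S)"
    by (rule clause) (use G Know.prems rel_openD in blast)+
  moreover have "fm_code c p \<le> n" using Know.prems(1) fm_code_less(5)[of c p] by linarith
  ultimately show ?case
    unfolding sat_coded_Know[OF Know.prems(2)] using Know.IH Know.prems(2) by metis
qed

text \<open>The true entries themselves form a table. Without existence within the bound, the
  universal quantifier over \<open>S\<close> in \<open>all_models_satisfy\<close> could hold
  vacuously.\<close>

lemma exists_truth_table:
  assumes c: "inj c"
    and G: "\<And>q. q \<le> n \<Longrightarrow> q \<in> set_decode G \<longleftrightarrow> q \<in> range (fm_code c)"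
  shows "\<exists>S<2 ^ Suc (entry n M (2 ^ M)). truth_table n M (c tt) (c ff) R I G S"
proof -
  let ?T = "rel_topology M (set_decode R)"
  let ?v = "coded_valuation c tt ff M (set_decode R) (set_decode I)"
  define A where "A = {entry (fm_code c p) x u | p x u.
    fm_code c p \<le> n \<and> x < M \<and> u < 2 ^ M \<and> sat ?T ?v x (set_decode u) p}"
  have bound: "A \<subseteq> {..entry n M (2 ^ M)}"
  proof
    fix k assume "k \<in> A"
    then obtain p x u where "k = entry (fm_code c p) x u" "fm_code c p \<le> n" "x < M" "u < 2 ^ M"
      unfolding A_def by blast
    then show "k \<in> {..entry n M (2 ^ M)}" using prod_encode_mono by simp
  qed
  define S where "S = set_encode A"
  have "S < 2 ^ Suc (entry n M (2 ^ M))"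
    unfolding S_def using bound by (intro set_encode_less) auto
  have "set_decode S = A" unfolding S_def by (rule set_decode_encode_bounded[OF bound])
  \<comment> \<open>Injectivity of the pairing and of \<open>fm_code\<close> lets an element of
    \<open>A\<close> be read back as a fact about this particular \<open>p\<close>, \<open>x\<close>
    and \<open>u\<close>.\<close>
  then have S: "entry (fm_code c p) x u \<in> set_decode S \<longleftrightarrow> sat ?T ?v x (set_decode u) p"
    if "fm_code c p \<le> n" "rel_open M R u" "x \<in> set_decode u" for p x u
    using that rel_openD[OF that(2)] rel_open_mem_less[OF that(2,3)] fm_code_inject[OF c]
    unfolding A_def by (auto simp: prod_encode_eq)
  have "truth_clause M (c tt) (c ff) R I S (fm_code c p) u x"
    if p: "fm_code c p \<le> n" and u: "rel_open M R u" "x \<in> set_decode u" for p u x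
  proof (cases p)
    case (Atom a)
    show ?thesis
      using S[OF p u] unfolding Atom truth_clause_fm_code sat_coded_Atom[OF c u] .
  next
    case (Conj p1 p2)
    have "fm_code c p1 \<le> n" "fm_code c p2 \<le> n"
      using p fm_code_less(1)[of c p1 p2] fm_code_less(2)[of c p2 p1] unfolding Conj by linarith+
    then show ?thesis
      using S[OF p u] S[OF _ u] unfolding Conj truth_clause_fm_code sat.simps by metis
  next
    case (Neg p1)
    have "fm_code c p1 \<le> n" using p fm_code_less(3)[of c p1] unfolding Neg by linarith
    then show ?thesis
      using S[OF p u] S[OF _ u] unfolding Neg truth_clause_fm_code sat.simps by metis
  next
    case (Box p1)
    have "fm_code c p1 \<le> n" using p fm_code_less(4)[of c p1] unfolding Box by linarith
    then show ?thesis
      using S[OF p u] S[of p1] unfolding Box truth_clause_fm_code sat_coded_Box[OF u(1)] by metis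
  next
    case (Know p1)
    have "fm_code c p1 \<le> n" using p fm_code_less(5)[of c p1] unfolding Know by linarith
    then show ?thesis
      using S[OF p u] S[of p1, OF _ u(1)]
      unfolding Know truth_clause_fm_code sat_coded_Know[OF u(1)] by metis
  qed
  then have "truth_table n M (c tt) (c ff) R I G S"
    unfolding truth_table_def using G by blast
  then show ?thesis using \<open>S < 2 ^ Suc (entry n M (2 ^ M))\<close> by blast
qed

section \<open>The arithmetical condition and validity\<close>

lemma all_models_satisfy_iff:
  assumes c: "inj c" and "tt \<noteq> ff"
  shows "all_models_satisfy (range c) (c tt) (c ff) (fm_code c p) \<longleftrightarrow>
    (\<forall>(T :: nat topology) i. topological_model tt ff T i \<longrightarrow>
      topspace T \<subseteq> {..<model_bound (fm_code c p)} \<longrightarrow> valid_in T i p)"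
proof -
  define n where "n = fm_code c p"
  define M where "M = model_bound n"
  let ?v = "\<lambda>R I. coded_valuation c tt ff M (set_decode R) (set_decode I)"
  show ?thesis
    unfolding n_def[symmetric] M_def[symmetric]
  proof (intro iffI allI impI)
    fix T :: "nat topology" and i
    assume all: "all_models_satisfy (range c) (c tt) (c ff) n"
      and model: "topological_model tt ff T i" and T: "topspace T \<subseteq> {..<M}"
    obtain G where G: "formula_table (range c) n G"
      and all: "\<And>R I S u x. R < 2 ^ Suc (prod_encode (M, M)) \<Longrightarrow>
        I < 2 ^ Suc (prod_encode (n, M)) \<Longrightarrow> S < 2 ^ Suc (entry n M (2 ^ M)) \<Longrightarrow>
        truth_table n M (c tt) (c ff) R I G S \<Longrightarrow> u < 2 ^ M \<Longrightarrow> rel_open M R u \<Longrightarrow> x < M \<Longrightarrow>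
        x \<in> set_decode u \<Longrightarrow> entry n x u \<in> set_decode S"
      using all unfolding all_models_satisfy_def M_def[symmetric] by blast
    note G' = formula_table_iff[OF G]
    obtain R I where RI: "R < 2 ^ Suc (prod_encode (M, M))" "I < 2 ^ Suc (prod_encode (n, M))"
      and R: "rel_topology M (set_decode R) = T"
      and sat: "\<And>x U. sat T (?v R I) x U p \<longleftrightarrow> sat T i x U p"
      using coded_model_cover[OF c T model, of p] unfolding n_def by blast
    \<comment> \<open>This table makes \<open>all\<close> applicable; \<open>truth_table_sat\<close>
      then turns the entry it yields into satisfaction.\<close>
    obtain S where S: "S < 2 ^ Suc (entry n M (2 ^ M))" "truth_table n M (c tt) (c ff) R I G S"
      using exists_truth_table[OF c G'] by blast
    show "valid_in T i p"
      unfolding valid_in_def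
    proof (intro allI impI)
      fix x U assume U: "openin T U \<and> x \<in> U"
      then obtain u where u: "U = set_decode u" "u < 2 ^ M" "rel_open M R u"
        unfolding R[symmetric] by (auto elim: openin_rel_topologyE)
      then have x: "x \<in> set_decode u" using U by simp
      have "entry n x u \<in> set_decode S"
        by (rule all[OF RI S u(2,3) rel_open_mem_less[OF u(3) x] x])
      then have "sat T (?v R I) x U p"
        using truth_table_sat[OF c G' S(2) _ u(3) x, of p] R u(1) unfolding n_def by simp
      then show "sat T i x U p" using sat by simp
    qed
  next
    assume valid: "\<forall>(T :: nat topology) i. topological_model tt ff T i \<longrightarrow>
      topspace T \<subseteq> {..<M} \<longrightarrow> valid_in T i p"
    obtain G where G: "G < 2 ^ Suc n" "formula_table (range c) n G"
      using exists_formula_table by blast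
    note G' = formula_table_iff[OF G(2)]
    have "entry n x u \<in> set_decode S"
      if S: "truth_table n M (c tt) (c ff) R I G S" and u: "rel_open M R u" "x \<in> set_decode u"
      for R I S u x
    proof -
      let ?T = "rel_topology M (set_decode R)"
      \<comment> \<open>Arbitrary codes \<open>R\<close> and \<open>I\<close> denote a model on
        points below \<open>M\<close>, so the assumption applies to them directly.\<close>
      have "valid_in ?T (?v R I) p"
        by (rule valid[rule_format, OF topological_model_coded[OF \<open>tt \<noteq> ff\<close>]])
          (auto simp: topspace_rel_topology)
      then have "sat ?T (?v R I) x (set_decode u) p"
        using u unfolding valid_in_def rel_open_iff by blast
      then show ?thesis
        using truth_table_sat[OF c G' S _ u, of p] unfolding n_def by simp
    qed
    moreover have "n \<in> set_decode G" using G'[of n] unfolding n_def by simp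
    ultimately show "all_models_satisfy (range c) (c tt) (c ff) n"
      unfolding all_models_satisfy_def M_def[symmetric] using G by blast
  qed
qed

text \<open>A countermodel over any type \<open>'y\<close> would shrink to one on an initial segment
  of \<open>nat\<close>.\<close>

lemma valid_if_all_models_satisfy:
  assumes c: "inj c" and "tt \<noteq> ff"
    and "all_models_satisfy (range c) (c tt) (c ff) (fm_code c p)"
  shows "valid TYPE('y) tt ff p"
proof -
  have "valid_in T i p"
    if "topological_model tt ff T i" "topspace T \<subseteq> {..<model_bound (fm_code c p)}"
    for T :: "nat topology" and i
    using assms(3) that unfolding all_models_satisfy_iff[OF c \<open>tt \<noteq> ff\<close>] by blast
  then show ?thesis
    unfolding valid_def
    using finite_model_property[OF c, of tt ff _ _ p "{..<model_bound (fm_code c p)}"]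
    by (metis card_lessThan finite_lessThan order_refl)
qed

text \<open>Infinity of \<open>'x\<close> provides a set \<open>Z\<close> of the required size. The
  countermodel on \<open>nat\<close> is already finite; \<open>finite_model_property\<close> is
  applied to it to relocate its points into \<open>Z\<close>.\<close>

lemma valid_iff_all_models_satisfy:
  fixes c :: "'a \<Rightarrow> nat" and tt ff :: 'a
  assumes c: "inj c" and "tt \<noteq> ff" and inf: "infinite (UNIV :: 'x set)"
  shows "valid TYPE('x) tt ff p \<longleftrightarrow> all_models_satisfy (range c) (c tt) (c ff) (fm_code c p)"
proof
  assume valid: "valid TYPE('x) tt ff p"
  obtain Z :: "'x set" where Z: "finite Z" "card Z = model_bound (fm_code c p)"
    using infinite_arbitrarily_large[OF inf] by metis
  show "all_models_satisfy (range c) (c tt) (c ff) (fm_code c p)"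
    unfolding all_models_satisfy_iff[OF c \<open>tt \<noteq> ff\<close>]
    using finite_model_property[OF c, where Z = Z] Z valid unfolding valid_def
    by (metis order_refl)
next
  assume "all_models_satisfy (range c) (c tt) (c ff) (fm_code c p)"
  then show "valid TYPE('x) tt ff p"
    by (rule valid_if_all_models_satisfy[OF c \<open>tt \<noteq> ff\<close>])
qed

text \<open>As \<open>'y\<close> is arbitrary, the second conjunct makes validity over one infinite
  type stand for validity in the models over every type, which justifies reading the first conjunct
  as decidability of the theory of all topological spaces.\<close>

theorem theorem24:
  fixes c :: "'a \<Rightarrow> nat" and tt ff :: 'a
  assumes "effective_enumeration c"
    and "tt \<noteq> ff"
    and "infinite (UNIV :: 'x set)"
  shows "decidable_fms c {p. valid TYPE('x) tt ff p} \<and>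
    (\<forall>p. valid TYPE('x) tt ff p \<longrightarrow> valid TYPE('y) tt ff p)"
proof -
  have c: "inj c" "decidable (range c)"
    using assms(1) unfolding effective_enumeration_def by auto
  note iff = valid_iff_all_models_satisfy[OF c(1) assms(2,3)]
  \<comment> \<open>Needed for equality of the two sets: no number satisfies the condition without
    being the code of a formula.\<close>
  have "n \<in> range (fm_code c)" if "all_models_satisfy (range c) (c tt) (c ff) n" for n
    using that formula_table_iff[of c n] unfolding all_models_satisfy_def by blast
  then have "fm_code c ` {p. valid TYPE('x) tt ff p} =
      {n. all_models_satisfy (range c) (c tt) (c ff) n}"
    using iff by auto
  then have "decidable_fms c {p. valid TYPE('x) tt ff p}"
    unfolding decidable_fms_def using decidable_all_models_satisfy[OF c(2)] by simp
  then show ?thesis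
    using iff valid_if_all_models_satisfy[OF c(1) assms(2)] by blast
qed

end
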